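(* Let $a\in\omega^\omega$. If there is a mad family $\mathcal A_0\subseteq[\omega]^\omega$ which is $\Sigma^1_2(a)$, then there is a mad family $\mathcal A\subseteq[\omega]^\omega$ which is $\Pi^1_1(a)$.
   Context: $[\omega]^\omega$ denotes the set of infinite subsets of $\omega$, viewed as a subset of the space $\mathcal P(\omega)\cong 2^\omega$ (identifying sets with characteristic functions). An almost disjoint family is a set $\mathcal A\subseteq[\omega]^\omega$ such that $x\cap y$ is finite for all distinct $x,y\in\mathcal A$. A mad (maximal almost disjoint) family is an infinite almost disjoint family $\mathcal A\subseteq[\omega]^\omega$ that is maximal under inclusion among almost disjoint families; equivalently, it is infinite and almost disjoint, and for every $z\in[\omega]^\omega$ there is $x\in\mathcal A$ with $x\cap z$ infinite. For a real parameter $a\in\omega^\omega$, $\Sigma^1_n(a)$ and $\Pi^1_n(a)$ denote the lightface (effective) projective pointclasses relativized to $a$: a set is $\Pi^1_1(a)$ if it is definable by a formula of second-order arithmetic of the form $\forall u\in\omega^\omega\,\varphi(u,x,a)$ with $\varphi$ arithmetical, and $\Sigma^1_2(a)$ if it is definable by a formula of the form $\exists v\in\omega^\omega\,\forall u\in\omega^\omega\,\varphi(u,v,x,a)$ with $\varphi$ arithmetical. *)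

theory Defs
  imports Main "HOL-Library.Indicator_Function"
begin

definition almost_disjoint_family :: "nat set set \<Rightarrow> bool" where
  "almost_disjoint_family \<A> \<longleftrightarrow>
     (\<forall>x\<in>\<A>. infinite x) \<and> pairwise (\<lambda>x y. finite (x \<inter> y)) \<A>"

definition mad_family :: "nat set set \<Rightarrow> bool" where
  "mad_family \<A> \<longleftrightarrow>
     infinite \<A> \<and> almost_disjoint_family \<A> \<and>
     (\<forall>\<B>. almost_disjoint_family \<B> \<and> \<A> \<subseteq> \<B> \<longrightarrow> \<B> = \<A>)"

text \<open>
  Two sorts of named variables, both indexed by natural numbers: number variables, and
  function variables ranging over all functions from naturals to naturals. The index in
  \<open>App\<close>, \<open>AllF\<close> and \<open>ExF\<close> is that of a function variable.
\<close>

datatype tm =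
    Var nat
  | Zero
  | Succ tm
  | Add tm tm
  | Mul tm tm
  | App nat tm

datatype fm =
    Eq tm tm
  | Less tm tm
  | Neg fm
  | Conj fm fm
  | Disj fm fm
  | AllN nat fm
  | ExN nat fm
  | AllF nat fm
  | ExF nat fm

primrec tm_val :: "(nat \<Rightarrow> nat) \<Rightarrow> (nat \<Rightarrow> nat \<Rightarrow> nat) \<Rightarrow> tm \<Rightarrow> nat" where
  "tm_val e s (Var i) = e i"
| "tm_val e s Zero = 0"
| "tm_val e s (Succ t) = Suc (tm_val e s t)"
| "tm_val e s (Add t t') = tm_val e s t + tm_val e s t'"
| "tm_val e s (Mul t t') = tm_val e s t * tm_val e s t'"
| "tm_val e s (App i t) = s i (tm_val e s t)"

primrec holds :: "(nat \<Rightarrow> nat) \<Rightarrow> (nat \<Rightarrow> nat \<Rightarrow> nat) \<Rightarrow> fm \<Rightarrow> bool" where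
  "holds e s (Eq t t') \<longleftrightarrow> tm_val e s t = tm_val e s t'"
| "holds e s (Less t t') \<longleftrightarrow> tm_val e s t < tm_val e s t'"
| "holds e s (Neg \<phi>) \<longleftrightarrow> \<not> holds e s \<phi>"
| "holds e s (Conj \<phi> \<psi>) \<longleftrightarrow> holds e s \<phi> \<and> holds e s \<psi>"
| "holds e s (Disj \<phi> \<psi>) \<longleftrightarrow> holds e s \<phi> \<or> holds e s \<psi>"
| "holds e s (AllN i \<phi>) \<longleftrightarrow> (\<forall>n. holds (e(i := n)) s \<phi>)"
| "holds e s (ExN i \<phi>) \<longleftrightarrow> (\<exists>n. holds (e(i := n)) s \<phi>)"
| "holds e s (AllF i \<phi>) \<longleftrightarrow> (\<forall>f. holds e (s(i := f)) \<phi>)"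
| "holds e s (ExF i \<phi>) \<longleftrightarrow> (\<exists>f. holds e (s(i := f)) \<phi>)"

primrec tm_num_vars :: "tm \<Rightarrow> nat set" where
  "tm_num_vars (Var i) = {i}"
| "tm_num_vars Zero = {}"
| "tm_num_vars (Succ t) = tm_num_vars t"
| "tm_num_vars (Add t t') = tm_num_vars t \<union> tm_num_vars t'"
| "tm_num_vars (Mul t t') = tm_num_vars t \<union> tm_num_vars t'"
| "tm_num_vars (App i t) = tm_num_vars t"

primrec tm_fun_vars :: "tm \<Rightarrow> nat set" where
  "tm_fun_vars (Var i) = {}"
| "tm_fun_vars Zero = {}"
| "tm_fun_vars (Succ t) = tm_fun_vars t"
| "tm_fun_vars (Add t t') = tm_fun_vars t \<union> tm_fun_vars t'"
| "tm_fun_vars (Mul t t') = tm_fun_vars t \<union> tm_fun_vars t'"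
| "tm_fun_vars (App i t) = insert i (tm_fun_vars t)"

primrec free_num_vars :: "fm \<Rightarrow> nat set" where
  "free_num_vars (Eq t t') = tm_num_vars t \<union> tm_num_vars t'"
| "free_num_vars (Less t t') = tm_num_vars t \<union> tm_num_vars t'"
| "free_num_vars (Neg \<phi>) = free_num_vars \<phi>"
| "free_num_vars (Conj \<phi> \<psi>) = free_num_vars \<phi> \<union> free_num_vars \<psi>"
| "free_num_vars (Disj \<phi> \<psi>) = free_num_vars \<phi> \<union> free_num_vars \<psi>"
| "free_num_vars (AllN i \<phi>) = free_num_vars \<phi> - {i}"
| "free_num_vars (ExN i \<phi>) = free_num_vars \<phi> - {i}"
| "free_num_vars (AllF i \<phi>) = free_num_vars \<phi>"
| "free_num_vars (ExF i \<phi>) = free_num_vars \<phi>"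

primrec free_fun_vars :: "fm \<Rightarrow> nat set" where
  "free_fun_vars (Eq t t') = tm_fun_vars t \<union> tm_fun_vars t'"
| "free_fun_vars (Less t t') = tm_fun_vars t \<union> tm_fun_vars t'"
| "free_fun_vars (Neg \<phi>) = free_fun_vars \<phi>"
| "free_fun_vars (Conj \<phi> \<psi>) = free_fun_vars \<phi> \<union> free_fun_vars \<psi>"
| "free_fun_vars (Disj \<phi> \<psi>) = free_fun_vars \<phi> \<union> free_fun_vars \<psi>"
| "free_fun_vars (AllN i \<phi>) = free_fun_vars \<phi>"
| "free_fun_vars (ExN i \<phi>) = free_fun_vars \<phi>"
| "free_fun_vars (AllF i \<phi>) = free_fun_vars \<phi> - {i}"
| "free_fun_vars (ExF i \<phi>) = free_fun_vars \<phi> - {i}"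

primrec arithmetical :: "fm \<Rightarrow> bool" where
  "arithmetical (Eq t t') \<longleftrightarrow> True"
| "arithmetical (Less t t') \<longleftrightarrow> True"
| "arithmetical (Neg \<phi>) \<longleftrightarrow> arithmetical \<phi>"
| "arithmetical (Conj \<phi> \<psi>) \<longleftrightarrow> arithmetical \<phi> \<and> arithmetical \<psi>"
| "arithmetical (Disj \<phi> \<psi>) \<longleftrightarrow> arithmetical \<phi> \<and> arithmetical \<psi>"
| "arithmetical (AllN i \<phi>) \<longleftrightarrow> arithmetical \<phi>"
| "arithmetical (ExN i \<phi>) \<longleftrightarrow> arithmetical \<phi>"
| "arithmetical (AllF i \<phi>) \<longleftrightarrow> False"
| "arithmetical (ExF i \<phi>) \<longleftrightarrow> False"

text \<open>
  Function variable 0 denotes the characteristic function of the set \<open>x\<close> and function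
  variable 1 the parameter \<open>a\<close>. There are no other free variables, so the values given
  to the remaining variables are irrelevant.
\<close>

definition defines_from :: "fm \<Rightarrow> (nat \<Rightarrow> nat) \<Rightarrow> nat set set \<Rightarrow> bool" where
  "defines_from \<psi> a \<A> \<longleftrightarrow>
     free_num_vars \<psi> = {} \<and> free_fun_vars \<psi> \<subseteq> {0, 1} \<and>
     \<A> = {x. holds (\<lambda>_. 0) ((\<lambda>_ _. 0)(0 := indicator x, 1 := a)) \<psi>}"

definition Pi11 :: "(nat \<Rightarrow> nat) \<Rightarrow> nat set set \<Rightarrow> bool" where
  "Pi11 a \<A> \<longleftrightarrow> (\<exists>u \<phi>. arithmetical \<phi> \<and> defines_from (AllF u \<phi>) a \<A>)"

definition Sigma12 :: "(nat \<Rightarrow> nat) \<Rightarrow> nat set set \<Rightarrow> bool" where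
  "Sigma12 a \<A> \<longleftrightarrow> (\<exists>v u \<phi>. arithmetical \<phi> \<and> defines_from (ExF v (AllF u \<phi>)) a \<A>)"

end

theory Submission
  imports Defs "HOL-Library.Nat_Bijection" "HOL-Library.Infinite_Set" "HOL-Number_Theory.Cong"
begin

text \<open>
  Write \<open>\<A>\<^sub>0\<close> as the projection of a \<open>\<Pi>\<^sup>1\<^sub>1\<close> relation and uniformize it, which gives every
  \<open>x \<in> \<A>\<^sub>0\<close> a single witness \<open>f x\<close> with \<open>\<Pi>\<^sup>1\<^sub>1\<close> graph. Replace \<open>x\<close> by its preimage under the two-to-one
  map \<open>m \<mapsto> m div 2\<close>, cut into two disjoint selectors whose bits, read along the increasing
  enumeration of \<open>x\<close>, code \<open>f x\<close> and the complementary sequence. A selector computes \<open>x\<close> and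
  \<open>f x\<close>, so the family of all selectors is \<open>\<Pi>\<^sup>1\<^sub>1\<close>; it is mad because the two halves together
  cover the whole preimage.

  Uniformization follows Kondo: the witness is least in the lexicographic order that alternates
  the ranks of the nodes of a well-founded tree with the values of the witness. Ranks are
  compared through simulations between trees, so no ordinals occur.
\<close>

section \<open>Arithmetical predicates\<close>

text \<open>A member of the new family must determine both \<open>x\<close> and its witness, so that
  the existential quantifier disappears; but sets that carry such codes usually no longer form a
  maximal family. Taking both halves of the preimage restores maximality, at the price that
  complementary bit sequences must code the same witness. A unique witness protects almost
  disjointness: selectors coding different witnesses over one \<open>x\<close> could meet in an
  infinite set. The final formula has only universal function quantifiers because leastness is
  refuted by existential data: a descending chain in the candidate's own tree, or a competitor
  together with a simulation of its tree in the candidate's tree. Since the pointclasses are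
  lightface, each construction has to be matched by an actual formula, and terms offer only
  successor, sum, product and application; this is why pairing and Goedel's function have to be
  developed arithmetically.\<close>

lemma tm_val_cong:
  "(\<And>i. i \<in> tm_num_vars t \<Longrightarrow> e i = e' i) \<Longrightarrow> tm_val e s t = tm_val e' s t"
  by (induction t) auto

lemma holds_cong:
  "(\<And>i. i \<in> free_num_vars \<phi> \<Longrightarrow> e i = e' i) \<Longrightarrow> holds e s \<phi> = holds e' s \<phi>"
proof (induction \<phi> arbitrary: e e' s)
  case (Eq t t')
  then show ?case using tm_val_cong[of t e e' s] tm_val_cong[of t' e e' s] by simp
next
  case (Less t t')
  then show ?case using tm_val_cong[of t e e' s] tm_val_cong[of t' e e' s] by simp
next
  case (Neg \<phi>)
  then show ?case by (metis free_num_vars.simps(3) holds.simps(3))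
next
  case (Conj \<phi> \<psi>)
  then show ?case by (metis UnCI free_num_vars.simps(4) holds.simps(4))
next
  case (Disj \<phi> \<psi>)
  then show ?case by (metis UnCI free_num_vars.simps(5) holds.simps(5))
next
  case (AllN i \<phi>)
  have "holds (e(i := n)) s \<phi> = holds (e'(i := n)) s \<phi>" for n
    by (rule AllN.IH) (use AllN.prems in auto)
  then show ?case by simp
next
  case (ExN i \<phi>)
  have "holds (e(i := n)) s \<phi> = holds (e'(i := n)) s \<phi>" for n
    by (rule ExN.IH) (use ExN.prems in auto)
  then show ?case by simp
next
  case (AllF i \<phi>)
  then show ?case by (metis free_num_vars.simps(8) holds.simps(8))
next
  case (ExF i \<phi>)
  then show ?case by (metis free_num_vars.simps(9) holds.simps(9))
qed

lemma finite_free_num_vars: "finite (free_num_vars \<phi>)"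
proof -
  have "finite (tm_num_vars t)" for t by (induction t) auto
  then show ?thesis by (induction \<phi>) auto
qed

section \<open>Renaming number variables without capture\<close>

lemma tm_rename: "\<exists>t'. \<forall>e s. tm_val e s t' = tm_val (\<lambda>i. e (\<rho> i)) s t"
proof (induction t)
  case (Var i)
  have "\<forall>e s. tm_val e s (Var (\<rho> i)) = tm_val (\<lambda>i. e (\<rho> i)) s (Var i)" by simp
  then show ?case by blast
next
  case Zero
  then show ?case by (metis tm_val.simps(2))
next
  case (Succ t)
  then show ?case by (metis tm_val.simps(3))
next
  case (Add t1 t2)
  then show ?case by (metis tm_val.simps(4))
next
  case (Mul t1 t2)
  then show ?case by (metis tm_val.simps(5))
next
  case (App x1 t)
  then show ?case by (metis tm_val.simps(6))
qed

text \<open>The renaming \<rho> need not be injective, so a bound name is replaced by some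
  \<open>k\<close> outside the image of the free variables; then updating \<open>k\<close> disturbs
  no other variable.\<close>

lemma fresh_update:
  assumes "k \<notin> \<rho> ` free_num_vars \<phi>"
  shows "holds (\<lambda>j. (e(k := n)) ((\<rho>(i := k)) j)) s \<phi> = holds ((\<lambda>j. e (\<rho> j))(i := n)) s \<phi>"
  by (rule holds_cong) (use assms in \<open>auto simp: image_iff\<close>)

lemma holds_rename:
  "arithmetical \<phi> \<Longrightarrow> \<exists>\<phi>'. arithmetical \<phi>' \<and> (\<forall>e s. holds e s \<phi>' \<longleftrightarrow> holds (\<lambda>i. e (\<rho> i)) s \<phi>)"
proof (induction \<phi> arbitrary: \<rho>)
  case (Eq t t')
  obtain u u' where "\<forall>e s. tm_val e s u = tm_val (\<lambda>i. e (\<rho> i)) s t"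
    "\<forall>e s. tm_val e s u' = tm_val (\<lambda>i. e (\<rho> i)) s t'"
    using tm_rename by meson
  then show ?case by (intro exI[of _ "Eq u u'"]) simp
next
  case (Less t t')
  obtain u u' where "\<forall>e s. tm_val e s u = tm_val (\<lambda>i. e (\<rho> i)) s t"
    "\<forall>e s. tm_val e s u' = tm_val (\<lambda>i. e (\<rho> i)) s t'"
    using tm_rename by meson
  then show ?case by (intro exI[of _ "Less u u'"]) simp
next
  case (Neg \<phi>)
  then show ?case by (metis arithmetical.simps(3) holds.simps(3))
next
  case (Conj \<phi> \<psi>)
  then show ?case by (metis arithmetical.simps(4) holds.simps(4))
next
  case (Disj \<phi> \<psi>)
  then show ?case by (metis arithmetical.simps(5) holds.simps(5))
next
  case (AllN i \<phi>)
  obtain k where k: "k \<notin> \<rho> ` free_num_vars \<phi>"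
    using finite_free_num_vars ex_new_if_finite infinite_UNIV_nat by blast
  obtain \<phi>' where \<phi>': "arithmetical \<phi>'"
    "\<And>e s. holds e s \<phi>' \<longleftrightarrow> holds (\<lambda>j. e ((\<rho>(i := k)) j)) s \<phi>"
    using AllN by (metis arithmetical.simps(6))
  show ?case
    by (rule exI[of _ "AllN k \<phi>'"]) (simp only: arithmetical.simps holds.simps \<phi>' fresh_update[OF k], simp)
next
  case (ExN i \<phi>)
  obtain k where k: "k \<notin> \<rho> ` free_num_vars \<phi>"
    using finite_free_num_vars ex_new_if_finite infinite_UNIV_nat by blast
  obtain \<phi>' where \<phi>': "arithmetical \<phi>'"
    "\<And>e s. holds e s \<phi>' \<longleftrightarrow> holds (\<lambda>j. e ((\<rho>(i := k)) j)) s \<phi>"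
    using ExN by (metis arithmetical.simps(7))
  show ?case
    by (rule exI[of _ "ExN k \<phi>'"]) (simp only: arithmetical.simps holds.simps \<phi>' fresh_update[OF k], simp)
qed auto

text \<open>
  Number variables follow the de Bruijn convention: under a quantifier the bound variable is
  \<open>e 0\<close> and the outer environment is \<open>\<lambda>i. e (Suc i)\<close>.
\<close>

definition arpred :: "((nat \<Rightarrow> nat) \<Rightarrow> (nat \<Rightarrow> nat \<Rightarrow> nat) \<Rightarrow> bool) \<Rightarrow> bool" where
  "arpred P \<longleftrightarrow> (\<exists>\<phi>. arithmetical \<phi> \<and> (\<forall>e s. holds e s \<phi> \<longleftrightarrow> P e s))"

text \<open>Functions enter through their graphs, with \<open>e 0\<close> as the value, and not
  through terms: division, remainder and unpairing are not terms of the language.\<close>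

definition arnum :: "((nat \<Rightarrow> nat) \<Rightarrow> (nat \<Rightarrow> nat \<Rightarrow> nat) \<Rightarrow> nat) \<Rightarrow> bool" where
  "arnum f \<longleftrightarrow> arpred (\<lambda>e s. e 0 = f (\<lambda>i. e (Suc i)) s)"

definition arfun :: "((nat \<Rightarrow> nat) \<Rightarrow> (nat \<Rightarrow> nat \<Rightarrow> nat) \<Rightarrow> nat \<Rightarrow> nat) \<Rightarrow> bool" where
  "arfun G \<longleftrightarrow> arnum (\<lambda>e s. G (\<lambda>i. e (Suc i)) s (e 0))"

lemma arpred_holds: "arithmetical \<phi> \<Longrightarrow> arpred (\<lambda>e s. holds e s \<phi>)"
  unfolding arpred_def by blast

lemma arpred_not: "arpred P \<Longrightarrow> arpred (\<lambda>e s. \<not> P e s)"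
  unfolding arpred_def by (metis arithmetical.simps(3) holds.simps(3))

lemma arpred_conj: "arpred P \<Longrightarrow> arpred Q \<Longrightarrow> arpred (\<lambda>e s. P e s \<and> Q e s)"
  unfolding arpred_def by (metis arithmetical.simps(4) holds.simps(4))

lemma arpred_disj: "arpred P \<Longrightarrow> arpred Q \<Longrightarrow> arpred (\<lambda>e s. P e s \<or> Q e s)"
  unfolding arpred_def by (metis arithmetical.simps(5) holds.simps(5))

lemma arpred_imp: "arpred P \<Longrightarrow> arpred Q \<Longrightarrow> arpred (\<lambda>e s. P e s \<longrightarrow> Q e s)"
  unfolding imp_conv_disj by (intro arpred_disj arpred_not)

lemma arpred_iff: "arpred P \<Longrightarrow> arpred Q \<Longrightarrow> arpred (\<lambda>e s. P e s \<longleftrightarrow> Q e s)"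
  unfolding iff_conv_conj_imp by (intro arpred_conj arpred_imp)

lemma arpred_rename: "arpred P \<Longrightarrow> arpred (\<lambda>e s. P (\<lambda>i. e (\<rho> i)) s)"
proof -
  assume "arpred P"
  then obtain \<phi> where \<phi>: "arithmetical \<phi>" "\<And>e s. holds e s \<phi> \<longleftrightarrow> P e s"
    unfolding arpred_def by blast
  obtain \<phi>' where "arithmetical \<phi>'" "\<And>e s. holds e s \<phi>' \<longleftrightarrow> holds (\<lambda>i. e (\<rho> i)) s \<phi>"
    using holds_rename[OF \<phi>(1)] by blast
  then show ?thesis
    unfolding arpred_def using \<phi>(2) by (intro exI[of _ \<phi>']) simp
qed

lemma arpred_ex:
  assumes "arpred (\<lambda>e s. Q (e 0) (\<lambda>i. e (Suc i)) s)"
  shows "arpred (\<lambda>e s. \<exists>n. Q n e s)"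
proof -
  obtain \<phi> where \<phi>: "arithmetical \<phi>" "\<And>e s. holds e s \<phi> \<longleftrightarrow> Q (e 0) (\<lambda>i. e (Suc i)) s"
    using assms unfolding arpred_def by blast
  obtain K where K: "\<And>i. i \<in> free_num_vars \<phi> \<Longrightarrow> i < K"
    using finite_free_num_vars finite_nat_set_iff_bounded by metis
  \<comment> \<open>The de Bruijn variable \<open>0\<close> becomes the named variable
    \<open>K\<close>, and a free \<open>Suc i\<close> becomes \<open>i < K\<close>, so quantifying
    over \<open>K\<close> captures nothing.\<close>
  define \<rho> where "\<rho> = (case_nat K (\<lambda>i. i))"
  obtain \<phi>' where \<phi>': "arithmetical \<phi>'" "\<And>e s. holds e s \<phi>' \<longleftrightarrow> holds (\<lambda>i. e (\<rho> i)) s \<phi>"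
    using holds_rename[OF \<phi>(1)] by metis
  have "holds (\<lambda>i. (e(K := n)) (\<rho> i)) s \<phi> = holds (case_nat n e) s \<phi>" for e s n
    by (rule holds_cong) (auto simp: \<rho>_def dest: K split: nat.split)
  then have "holds e s (ExN K \<phi>') \<longleftrightarrow> (\<exists>n. Q n e s)" for e s
    by (simp only: holds.simps \<phi>' \<phi>) simp
  then show ?thesis
    unfolding arpred_def using \<phi>'(1) by (metis arithmetical.simps(7))
qed

lemma arpred_all:
  assumes "arpred (\<lambda>e s. Q (e 0) (\<lambda>i. e (Suc i)) s)"
  shows "arpred (\<lambda>e s. \<forall>n. Q n e s)"
  using arpred_not[OF arpred_ex[OF arpred_not[OF assms]]] by simp

text \<open>A definable value is named by an existential number quantifier, which keeps the formula
  arithmetical.\<close>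

lemma arpred_let:
  assumes "arpred (\<lambda>e s. Q (e 0) (\<lambda>i. e (Suc i)) s)" "arnum f"
  shows "arpred (\<lambda>e s. Q (f e s) e s)"
proof -
  have "arpred (\<lambda>e s. \<exists>n. n = f e s \<and> Q n e s)"
    by (rule arpred_ex) (intro arpred_conj assms(1) assms(2)[unfolded arnum_def])
  then show ?thesis by simp
qed

lemma arnum_rename: "arnum f \<Longrightarrow> arnum (\<lambda>e s. f (\<lambda>i. e (\<rho> i)) s)"
  unfolding arnum_def
  by (drule arpred_rename[where \<rho> = "case_nat 0 (\<lambda>i. Suc (\<rho> i))"]) simp

lemma arnum_shift: "arnum f \<Longrightarrow> arnum (\<lambda>e s. f (\<lambda>i. e (Suc i)) s)"
  by (rule arnum_rename)

lemma arfun_rename: "arfun G \<Longrightarrow> arfun (\<lambda>e s. G (\<lambda>i. e (\<rho> i)) s)"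
  unfolding arfun_def
  by (drule arnum_rename[where \<rho> = "case_nat 0 (\<lambda>i. Suc (\<rho> i))"]) simp

lemma arfun_shift: "arfun G \<Longrightarrow> arfun (\<lambda>e s. G (\<lambda>i. e (Suc i)) s)"
  by (rule arfun_rename)

lemma arpred_rel2:
  assumes H: "arpred (\<lambda>e s. H (e 0) (e 1) s)" and "arnum f" "arnum g"
  shows "arpred (\<lambda>e s. H (f e s) (g e s) s)"
proof (rule arpred_let[where Q = "\<lambda>n e s. H n (g e s) s", OF _ assms(2)])
  have "arpred (\<lambda>e s. H (e 1) (e 0) s)"
    using arpred_rename[OF H, of "\<lambda>i. if i = 0 then 1 else 0"] by simp
  then show "arpred (\<lambda>e s. H (e 0) (g (\<lambda>i. e (Suc i)) s) s)"
    by (intro arpred_let[where Q = "\<lambda>n e s. H (e 0) n s", OF _ arnum_shift[OF assms(3)]]) simp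
qed

lemma arnum_op2:
  assumes H: "arpred (\<lambda>e s. e 0 = h (e 1) (e 2))" and "arnum f" "arnum g"
  shows "arnum (\<lambda>e s. h (f e s) (g e s))"
  unfolding arnum_def
proof (rule arpred_let[where Q = "\<lambda>n e s. e 0 = h n (g (\<lambda>i. e (Suc i)) s)", OF _ arnum_shift[OF assms(2)]])
  have "arpred (\<lambda>e s. e 2 = h (e 1) (e 0))"
    using arpred_rename[OF H, of "\<lambda>i. if i = 0 then 2 else if i = 1 then 1 else 0"] by simp
  then show "arpred (\<lambda>e s. e (Suc 0) = h (e 0) (g (\<lambda>i. e (Suc (Suc i))) s))"
    by (intro arpred_let[where Q = "\<lambda>n e s. e 1 = h (e 0) n", OF _ arnum_rename[OF assms(3)], simplified])
      (simp add: numeral_2_eq_2)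
qed

lemma arnum_op1:
  assumes H: "arpred (\<lambda>e s. e 0 = h (e 1) s)" and "arnum f"
  shows "arnum (\<lambda>e s. h (f e s) s)"
  unfolding arnum_def
proof (rule arpred_let[where Q = "\<lambda>n e s. e 0 = h n s", OF _ arnum_shift[OF assms(2)]])
  show "arpred (\<lambda>e s. e (Suc 0) = h (e 0) s)"
    using arpred_rename[OF H, of "\<lambda>i. if i = 0 then 1 else 0"] by simp
qed

lemma arnum_var: "arnum (\<lambda>e s. e i)"
  unfolding arnum_def arpred_def
  by (rule exI[of _ "Eq (Var 0) (Var (Suc i))"]) simp

lemma arnum_const: "arnum (\<lambda>e s. n)"
proof -
  have "\<exists>t. \<forall>e s. tm_val e s t = n" by (induction n) (metis tm_val.simps(2), metis tm_val.simps(3))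
  then obtain t where "\<And>e s. tm_val e s t = n" by blast
  then show ?thesis
    unfolding arnum_def arpred_def by (intro exI[of _ "Eq (Var 0) t"]) simp
qed

lemma arnum_Suc: "arnum f \<Longrightarrow> arnum (\<lambda>e s. Suc (f e s))"
proof (rule arnum_op1[where h = "\<lambda>n s. Suc n"])
  show "arpred (\<lambda>e s. e 0 = Suc (e 1))"
    unfolding arpred_def by (rule exI[of _ "Eq (Var 0) (Succ (Var 1))"]) simp
qed

lemma arnum_add: "arnum f \<Longrightarrow> arnum g \<Longrightarrow> arnum (\<lambda>e s. f e s + g e s)"
proof (rule arnum_op2[where h = "(+)"])
  show "arpred (\<lambda>e s. e 0 = e 1 + e 2)"
    unfolding arpred_def by (rule exI[of _ "Eq (Var 0) (Add (Var 1) (Var 2))"]) simp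
qed

lemma arnum_mult: "arnum f \<Longrightarrow> arnum g \<Longrightarrow> arnum (\<lambda>e s. f e s * g e s)"
proof (rule arnum_op2[where h = "(*)"])
  show "arpred (\<lambda>e s. e 0 = e 1 * e 2)"
    unfolding arpred_def by (rule exI[of _ "Eq (Var 0) (Mul (Var 1) (Var 2))"]) simp
qed

lemma arnum_app: "arnum f \<Longrightarrow> arnum (\<lambda>e s. s i (f e s))"
proof (rule arnum_op1[where h = "\<lambda>n s. s i n"])
  show "arpred (\<lambda>e s. e 0 = s i (e 1))"
    unfolding arpred_def by (rule exI[of _ "Eq (Var 0) (App i (Var 1))"]) simp
qed

lemma arpred_eq: "arnum f \<Longrightarrow> arnum g \<Longrightarrow> arpred (\<lambda>e s. f e s = g e s)"
proof (rule arpred_rel2[where H = "\<lambda>m n s. m = n"])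
  show "arpred (\<lambda>e s. e 0 = e 1)"
    unfolding arpred_def by (rule exI[of _ "Eq (Var 0) (Var 1)"]) simp
qed

lemma arpred_less: "arnum f \<Longrightarrow> arnum g \<Longrightarrow> arpred (\<lambda>e s. f e s < g e s)"
proof (rule arpred_rel2[where H = "\<lambda>m n s. m < n"])
  show "arpred (\<lambda>e s. e 0 < e 1)"
    unfolding arpred_def by (rule exI[of _ "Less (Var 0) (Var 1)"]) simp
qed

lemma arnum_apply:
  assumes "arfun G" "arnum f"
  shows "arnum (\<lambda>e s. G e s (f e s))"
  unfolding arnum_def
proof (rule arpred_let[where Q = "\<lambda>n e s. e 0 = G (\<lambda>i. e (Suc i)) s n", OF _ arnum_shift[OF assms(2)]])
  show "arpred (\<lambda>e s. e (Suc 0) = G (\<lambda>i. e (Suc (Suc i))) s (e 0))"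
    using arpred_rename[OF assms(1)[unfolded arfun_def arnum_def],
        of "\<lambda>i. if i = 0 then 1 else if i = 1 then 0 else i"] by (simp add: numeral_2_eq_2)
qed

lemma arnum_tm_val:
  assumes "\<And>i. arnum (\<lambda>e s. F e s i)" "\<And>i. arfun (\<lambda>e s. G e s i)"
  shows "arnum (\<lambda>e s. tm_val (F e s) (G e s) t)"
proof (induction t)
  case (App i t)
  then show ?case using arnum_apply[OF assms(2) App.IH] by simp
qed (auto intro: assms arnum_const arnum_Suc arnum_add arnum_mult)

text \<open>Induction on the formula allows definable functions to replace function variables: at
  \<open>App\<close> the argument is itself only definable, and \<open>arnum_apply\<close> composes
  the two graphs. Under a quantifier the bound variable receives \<open>e 0\<close> and everything
  else is shifted.\<close>

lemma arpred_holds_subst: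
  assumes "arithmetical \<phi>" "\<And>i. arnum (\<lambda>e s. F e s i)" "\<And>i. arfun (\<lambda>e s. G e s i)"
  shows "arpred (\<lambda>e s. holds (F e s) (G e s) \<phi>)"
  using assms
proof (induction \<phi> arbitrary: F G)
  case (AllN j \<phi>)
  have "arpred (\<lambda>e s. holds ((F (\<lambda>i. e (Suc i)) s)(j := e 0)) (G (\<lambda>i. e (Suc i)) s) \<phi>)"
  proof (rule AllN.IH)
    show "arnum (\<lambda>e s. ((F (\<lambda>i. e (Suc i)) s)(j := e 0)) i)" for i
      by (cases "i = j") (simp_all add: arnum_var arnum_shift[OF AllN.prems(2)[of i]])
  qed (use AllN.prems in \<open>auto intro: arfun_shift\<close>)
  from arpred_all[where Q = "\<lambda>n e s. holds ((F e s)(j := n)) (G e s) \<phi>", OF this] show ?case by simp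
next
  case (ExN j \<phi>)
  have "arpred (\<lambda>e s. holds ((F (\<lambda>i. e (Suc i)) s)(j := e 0)) (G (\<lambda>i. e (Suc i)) s) \<phi>)"
  proof (rule ExN.IH)
    show "arnum (\<lambda>e s. ((F (\<lambda>i. e (Suc i)) s)(j := e 0)) i)" for i
      by (cases "i = j") (simp_all add: arnum_var arnum_shift[OF ExN.prems(2)[of i]])
  qed (use ExN.prems in \<open>auto intro: arfun_shift\<close>)
  from arpred_ex[where Q = "\<lambda>n e s. holds ((F e s)(j := n)) (G e s) \<phi>", OF this] show ?case by simp
next
  case (Eq t t')
  then show ?case by (simp add: arpred_eq arnum_tm_val)
next
  case (Less t t')
  then show ?case by (simp add: arpred_less arnum_tm_val)
qed (simp_all add: arpred_not arpred_conj arpred_disj)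

theorem arpred_subst:
  assumes "arpred P" "\<And>i. arnum (\<lambda>e s. F e s i)" "\<And>i. arfun (\<lambda>e s. G e s i)"
  shows "arpred (\<lambda>e s. P (F e s) (G e s))"
proof -
  obtain \<phi> where \<phi>: "arithmetical \<phi>" "\<And>e s. holds e s \<phi> \<longleftrightarrow> P e s"
    using assms(1) unfolding arpred_def by blast
  show ?thesis
    using arpred_holds_subst[OF \<phi>(1), of F G] assms(2,3) unfolding \<phi>(2) by blast
qed

lemma arfunI: "arnum (\<lambda>e s. G (\<lambda>i. e (Suc i)) s (e 0)) \<Longrightarrow> arfun G"
  unfolding arfun_def .

lemma arfun_var: "arfun (\<lambda>e s. s i)"
  by (intro arfunI arnum_app arnum_var)

section \<open>From semantic definability to the syntactic conditions on free variables\<close>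

lemma tm_restrict_fun_vars:
  "\<exists>t'. tm_fun_vars t' \<subseteq> S \<and> (\<forall>e s. tm_val e s t' = tm_val e (\<lambda>i. if i \<in> S then s i else (\<lambda>_. 0)) t)"
proof (induction t)
  case (Var i)
  then show ?case by (intro exI[of _ "Var i"]) simp
next
  case Zero
  then show ?case by (intro exI[of _ Zero]) simp
next
  case (Succ t)
  then obtain t' where "tm_fun_vars t' \<subseteq> S" "\<And>e s. tm_val e s t' = tm_val e (\<lambda>i. if i \<in> S then s i else (\<lambda>_. 0)) t" by blast
  then show ?case by (intro exI[of _ "Succ t'"]) simp
next
  case (Add t u)
  then obtain t' u' where "tm_fun_vars t' \<subseteq> S" "\<And>e s. tm_val e s t' = tm_val e (\<lambda>i. if i \<in> S then s i else (\<lambda>_. 0)) t"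
    "tm_fun_vars u' \<subseteq> S" "\<And>e s. tm_val e s u' = tm_val e (\<lambda>i. if i \<in> S then s i else (\<lambda>_. 0)) u" by blast
  then show ?case by (intro exI[of _ "Add t' u'"]) simp
next
  case (Mul t u)
  then obtain t' u' where "tm_fun_vars t' \<subseteq> S" "\<And>e s. tm_val e s t' = tm_val e (\<lambda>i. if i \<in> S then s i else (\<lambda>_. 0)) t"
    "tm_fun_vars u' \<subseteq> S" "\<And>e s. tm_val e s u' = tm_val e (\<lambda>i. if i \<in> S then s i else (\<lambda>_. 0)) u" by blast
  then show ?case by (intro exI[of _ "Mul t' u'"]) simp
next
  case (App j t)
  then obtain t' where "tm_fun_vars t' \<subseteq> S" "\<And>e s. tm_val e s t' = tm_val e (\<lambda>i. if i \<in> S then s i else (\<lambda>_. 0)) t" by blast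
  then show ?case by (intro exI[of _ "if j \<in> S then App j t' else Zero"]) simp
qed

text \<open>\<open>arpred\<close> controls only the meaning of a formula, whereas
  \<open>defines_from\<close> restricts the variables that occur in it. Stray function variables are
  read as the zero function, which turns their applications into \<open>Zero\<close>.\<close>

lemma fm_restrict_fun_vars:
  "arithmetical \<phi> \<Longrightarrow> \<exists>\<phi>'. arithmetical \<phi>' \<and> free_fun_vars \<phi>' \<subseteq> S \<and>
     (\<forall>e s. holds e s \<phi>' \<longleftrightarrow> holds e (\<lambda>i. if i \<in> S then s i else (\<lambda>_. 0)) \<phi>)"
proof (induction \<phi>)
  case (Eq t u)
  obtain t' u' where "tm_fun_vars t' \<subseteq> S" "\<And>e s. tm_val e s t' = tm_val e (\<lambda>i. if i \<in> S then s i else (\<lambda>_. 0)) t"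
    "tm_fun_vars u' \<subseteq> S" "\<And>e s. tm_val e s u' = tm_val e (\<lambda>i. if i \<in> S then s i else (\<lambda>_. 0)) u"
    using tm_restrict_fun_vars by meson
  then show ?case by (intro exI[of _ "Eq t' u'"]) simp
next
  case (Less t u)
  obtain t' u' where "tm_fun_vars t' \<subseteq> S" "\<And>e s. tm_val e s t' = tm_val e (\<lambda>i. if i \<in> S then s i else (\<lambda>_. 0)) t"
    "tm_fun_vars u' \<subseteq> S" "\<And>e s. tm_val e s u' = tm_val e (\<lambda>i. if i \<in> S then s i else (\<lambda>_. 0)) u"
    using tm_restrict_fun_vars by meson
  then show ?case by (intro exI[of _ "Less t' u'"]) simp
next
  case (Neg \<phi>)
  then obtain \<phi>' where "arithmetical \<phi>'" "free_fun_vars \<phi>' \<subseteq> S"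
     "\<And>e s. holds e s \<phi>' \<longleftrightarrow> holds e (\<lambda>i. if i \<in> S then s i else (\<lambda>_. 0)) \<phi>" by auto
  then show ?case by (intro exI[of _ "Neg \<phi>'"]) simp
next
  case (Conj \<phi> \<psi>)
  then obtain \<phi>' \<psi>' where "arithmetical \<phi>'" "free_fun_vars \<phi>' \<subseteq> S"
     "\<And>e s. holds e s \<phi>' \<longleftrightarrow> holds e (\<lambda>i. if i \<in> S then s i else (\<lambda>_. 0)) \<phi>"
     "arithmetical \<psi>'" "free_fun_vars \<psi>' \<subseteq> S"
     "\<And>e s. holds e s \<psi>' \<longleftrightarrow> holds e (\<lambda>i. if i \<in> S then s i else (\<lambda>_. 0)) \<psi>" by auto
  then show ?case by (intro exI[of _ "Conj \<phi>' \<psi>'"]) simp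
next
  case (Disj \<phi> \<psi>)
  then obtain \<phi>' \<psi>' where "arithmetical \<phi>'" "free_fun_vars \<phi>' \<subseteq> S"
     "\<And>e s. holds e s \<phi>' \<longleftrightarrow> holds e (\<lambda>i. if i \<in> S then s i else (\<lambda>_. 0)) \<phi>"
     "arithmetical \<psi>'" "free_fun_vars \<psi>' \<subseteq> S"
     "\<And>e s. holds e s \<psi>' \<longleftrightarrow> holds e (\<lambda>i. if i \<in> S then s i else (\<lambda>_. 0)) \<psi>" by auto
  then show ?case by (intro exI[of _ "Disj \<phi>' \<psi>'"]) simp
next
  case (AllN i \<phi>)
  then obtain \<phi>' where "arithmetical \<phi>'" "free_fun_vars \<phi>' \<subseteq> S"
     "\<And>e s. holds e s \<phi>' \<longleftrightarrow> holds e (\<lambda>i. if i \<in> S then s i else (\<lambda>_. 0)) \<phi>" by auto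
  then show ?case by (intro exI[of _ "AllN i \<phi>'"]) simp
next
  case (ExN i \<phi>)
  then obtain \<phi>' where "arithmetical \<phi>'" "free_fun_vars \<phi>' \<subseteq> S"
     "\<And>e s. holds e s \<phi>' \<longleftrightarrow> holds e (\<lambda>i. if i \<in> S then s i else (\<lambda>_. 0)) \<phi>" by auto
  then show ?case by (intro exI[of _ "ExN i \<phi>'"]) simp
qed auto

text \<open>Binding a stray number variable by \<open>ExN\<close> changes nothing when the truth
  value does not depend on the environment; each binding removes one free variable.\<close>

lemma fm_close_num_vars:
  assumes "arithmetical \<phi>"
  shows "\<exists>\<phi>'. arithmetical \<phi>' \<and> free_num_vars \<phi>' = {} \<and> free_fun_vars \<phi>' = free_fun_vars \<phi> \<and>
    (\<forall>s. (\<forall>e e'. holds e s \<phi> = holds e' s \<phi>) \<longrightarrow> (\<forall>e. holds e s \<phi>' = holds e s \<phi>))"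
  using assms
proof (induction "card (free_num_vars \<phi>)" arbitrary: \<phi>)
  case 0
  then show ?case using finite_free_num_vars[of \<phi>] by auto
next
  case (Suc n)
  then obtain i where i: "i \<in> free_num_vars \<phi>" by fastforce
  have "n = card (free_num_vars (ExN i \<phi>))"
    using Suc.hyps(2) i finite_free_num_vars[of \<phi>] by (simp add: card_Diff_singleton)
  from Suc.hyps(1)[OF this] Suc.prems obtain \<phi>' where \<phi>': "arithmetical \<phi>'" "free_num_vars \<phi>' = {}"
    "free_fun_vars \<phi>' = free_fun_vars \<phi>"
    "\<And>s. (\<forall>e e'. holds e s (ExN i \<phi>) = holds e' s (ExN i \<phi>)) \<Longrightarrow> (\<forall>e. holds e s \<phi>' = holds e s (ExN i \<phi>))"
    by auto
  show ?case
  proof (intro exI[of _ \<phi>'] conjI allI impI \<phi>')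
    fix s e assume "\<forall>e e'. holds e s \<phi> = holds e' s \<phi>"
    then have "holds e s (ExN i \<phi>) = holds e s \<phi>" for e by (metis holds.simps(7))
    with \<phi>'(4)[of s] \<open>\<forall>e e'. holds e s \<phi> = holds e' s \<phi>\<close> show "holds e s \<phi>' = holds e s \<phi>" by metis
  qed
qed

lemma Pi11I:
  assumes "arpred (\<lambda>e s. \<Psi> (s 0) (s 1) (s 2))"
  shows "Pi11 a {x. \<forall>u. \<Psi> (indicator x) a u}"
proof -
  obtain \<phi> where \<phi>: "arithmetical \<phi>" "\<And>e s. holds e s \<phi> \<longleftrightarrow> \<Psi> (s 0) (s 1) (s 2)"
    using assms unfolding arpred_def by auto
  obtain \<phi>1 where \<phi>1: "arithmetical \<phi>1" "free_fun_vars \<phi>1 \<subseteq> {0,1,2}"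
    "\<And>e s. holds e s \<phi>1 \<longleftrightarrow> holds e (\<lambda>i. if i \<in> {0,1,2} then s i else (\<lambda>_. 0)) \<phi>"
    using fm_restrict_fun_vars[OF \<phi>(1), of "{0,1,2}"] by auto
  have h1: "holds e s \<phi>1 \<longleftrightarrow> \<Psi> (s 0) (s 1) (s 2)" for e s
    unfolding \<phi>1 \<phi> by simp
  obtain \<phi>2 where \<phi>2: "arithmetical \<phi>2" "free_num_vars \<phi>2 = {}" "free_fun_vars \<phi>2 \<subseteq> {0,1,2}"
    "\<And>e s. holds e s \<phi>2 \<longleftrightarrow> \<Psi> (s 0) (s 1) (s 2)"
    using fm_close_num_vars[OF \<phi>1(1)] h1 \<phi>1(2) by auto
  show ?thesis
    unfolding Pi11_def defines_from_def
    by (intro exI[of _ 2] exI[of _ \<phi>2]) (use \<phi>2 in auto)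
qed

section \<open>Arithmetic of pairing and of finite sequences\<close>

lemma arnum_div2: "arnum f \<Longrightarrow> arnum (\<lambda>e s. f e s div 2)"
proof (rule arnum_op1[where h = "\<lambda>n s. n div 2"])
  have "arpred (\<lambda>e s. e 1 = e 0 + e 0 \<or> e 1 = Suc (e 0 + e 0))"
    by (intro arpred_disj arpred_eq arnum_add arnum_Suc arnum_var)
  moreover have "m = n div 2 \<longleftrightarrow> n = m + m \<or> n = Suc (m + m)" for m n :: nat
    by presburger
  ultimately show "arpred (\<lambda>e s. e 0 = e 1 div 2)" by presburger
qed

lemma arnum_prod_encode:
  "arnum f \<Longrightarrow> arnum g \<Longrightarrow> arnum (\<lambda>e s. prod_encode (f e s, g e s))"
  unfolding prod_encode_def triangle_def case_prod_conv
  by (intro arnum_add arnum_div2 arnum_mult arnum_Suc)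

lemma arnum_fst_prod_decode: "arnum f \<Longrightarrow> arnum (\<lambda>e s. fst (prod_decode (f e s)))"
proof (rule arnum_op1[where h = "\<lambda>n s. fst (prod_decode n)"])
  have "arpred (\<lambda>e s. \<exists>n. e 1 = prod_encode (e 0, n))"
    by (intro arpred_ex arpred_eq arnum_prod_encode arnum_var)
  moreover have "m = fst (prod_decode k) \<longleftrightarrow> (\<exists>n. k = prod_encode (m, n))" for m k
    by (metis fst_conv prod.collapse prod_decode_inverse prod_encode_inverse)
  ultimately show "arpred (\<lambda>e s. e 0 = fst (prod_decode (e 1)))" by presburger
qed

lemma arnum_snd_prod_decode: "arnum f \<Longrightarrow> arnum (\<lambda>e s. snd (prod_decode (f e s)))"
proof (rule arnum_op1[where h = "\<lambda>n s. snd (prod_decode n)"])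
  have "arpred (\<lambda>e s. \<exists>n. e 1 = prod_encode (n, e 0))"
    by (intro arpred_ex arpred_eq arnum_prod_encode arnum_var)
  moreover have "m = snd (prod_decode k) \<longleftrightarrow> (\<exists>n. k = prod_encode (n, m))" for m k
    by (metis snd_conv prod.collapse prod_decode_inverse prod_encode_inverse)
  ultimately show "arpred (\<lambda>e s. e 0 = snd (prod_decode (e 1)))" by presburger
qed

lemma arnum_mod_Suc: "arnum f \<Longrightarrow> arnum g \<Longrightarrow> arnum (\<lambda>e s. f e s mod Suc (g e s))"
proof (rule arnum_op2[where h = "\<lambda>m n. m mod Suc n"])
  have "arpred (\<lambda>e s. e 0 < Suc (e 2) \<and> (\<exists>q. e 1 = q * Suc (e 2) + e 0))"
    by (intro arpred_ex arpred_conj arpred_eq arpred_less arnum_add arnum_mult arnum_Suc arnum_var)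
  moreover have "r = m mod Suc n \<longleftrightarrow> r < Suc n \<and> (\<exists>q. m = q * Suc n + r)" for m n r
    by (metis div_mult_mod_eq mod_less mod_less_divisor mod_mult_self3 zero_less_Suc)
  ultimately show "arpred (\<lambda>e s. e 0 = e 1 mod Suc (e 2))" by presburger
qed

text \<open>Goedel's function; the code \<open>p\<close> also plays the role of the finite sequence it begins with.\<close>

definition beta :: "nat \<Rightarrow> nat \<Rightarrow> nat" where
  "beta p i = fst (prod_decode p) mod Suc (snd (prod_decode p) * Suc i)"

lemma arnum_beta: "arnum f \<Longrightarrow> arnum g \<Longrightarrow> arnum (\<lambda>e s. beta (f e s) (g e s))"
  unfolding beta_def
  by (intro arnum_mod_Suc arnum_mult arnum_Suc arnum_fst_prod_decode arnum_snd_prod_decode)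

lemma beta_surj: "\<exists>p. \<forall>i<N. beta p i = f i"
proof -
  \<comment> \<open>\<open>M\<close> bounds the indices and the values: differences of indices below
    \<open>N\<close> then divide \<open>fact M\<close>, which makes the moduli coprime, and every
    \<open>f i\<close> lies below its modulus.\<close>
  define M where "M = N + sum f {..<N}"
  define d where "d = (fact M :: nat)"
  have cop: "coprime (Suc (d * Suc i)) (Suc (d * Suc j))" if "i < j" "j < N" for i j
  proof (rule ccontr)
    assume "\<not> coprime (Suc (d * Suc i)) (Suc (d * Suc j))"
    then obtain q where q: "prime q" "q dvd Suc (d * Suc i)" "q dvd Suc (d * Suc j)"
      using not_coprimeE by (metis coprime_iff_gcd_eq_1 gcd_nat.boundedE prime_factor_nat)
    have "Suc (d * Suc j) - Suc (d * Suc i) = d * (j - i)"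
      using that by (simp add: diff_mult_distrib2)
    then have "q dvd d * (j - i)" using dvd_diff_nat[OF q(3,2)] by simp
    moreover have "j - i dvd d" unfolding d_def
      by (rule dvd_fact) (use that in \<open>auto simp: M_def\<close>)
    ultimately have "q dvd d" using q(1) by (meson dvd_trans prime_dvd_mult_iff)
    then have "q dvd d * Suc i" by simp
    with q(2) have "q dvd 1" by (metis Suc_eq_plus1 dvd_add_right_iff)
    with q(1) show False by (simp add: not_prime_unit)
  qed
  have "\<forall>i\<in>{..<N}. \<forall>j\<in>{..<N}. i \<noteq> j \<longrightarrow> coprime (Suc (d * Suc i)) (Suc (d * Suc j))"
  proof (intro ballI impI)
    fix i j assume "i \<in> {..<N}" "j \<in> {..<N}" "i \<noteq> j"
    then show "coprime (Suc (d * Suc i)) (Suc (d * Suc j))"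
      using cop[of i j] cop[of j i] coprime_commute by (metis lessThan_iff linorder_neqE_nat)
  qed
  with chinese_remainder_nat[of "{..<N}" "\<lambda>i. Suc (d * Suc i)" f]
  obtain c where c: "\<forall>i\<in>{..<N}. [c = f i] (mod Suc (d * Suc i))" by auto
  have "beta (prod_encode (c, d)) i = f i" if "i < N" for i
  proof -
    have "f i \<le> sum f {..<N}" using that by (intro member_le_sum) auto
    also have "\<dots> \<le> M" unfolding M_def by simp
    also have "M \<le> d" unfolding d_def by (rule fact_ge_self)
    also have "d < Suc (d * Suc i)" by simp
    finally have "f i < Suc (d * Suc i)" .
    then show ?thesis using c that unfolding beta_def cong_def by simp
  qed
  then show ?thesis by blast
qed

section \<open>Continuous normal form\<close>

text \<open>
  A kernel is the matrix of \<open>\<exists>w. \<forall>n. \<theta> n w e s\<close>. The continuity in \<open>s\<close>, and not only in the Skolem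
  function \<open>w\<close>, is what makes the limit argument of the uniformization theorem work.
\<close>

type_synonym kernel = "nat \<Rightarrow> (nat \<Rightarrow> nat) \<Rightarrow> (nat \<Rightarrow> nat) \<Rightarrow> (nat \<Rightarrow> nat \<Rightarrow> nat) \<Rightarrow> bool"

text \<open>The environment \<open>e\<close> stays fixed, since number variables are discrete; the
  bound \<open>N\<close> may depend on the point, so no uniformity is claimed.\<close>

definition continuous_kernel :: "kernel \<Rightarrow> bool" where
  "continuous_kernel \<theta> \<longleftrightarrow> (\<forall>n w e s. \<exists>N. \<forall>w' s'.
     (\<forall>i<N. w' i = w i) \<and> (\<forall>i<N. \<forall>j<N. s' i j = s i j) \<longrightarrow> \<theta> n w' e s' = \<theta> n w e s)"

definition kernel :: "kernel \<Rightarrow> bool" where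
  "kernel \<theta> \<longleftrightarrow> continuous_kernel \<theta> \<and>
     arpred (\<lambda>e s. \<theta> (e 0) (s 0) (\<lambda>i. e (Suc i)) (\<lambda>i. s (Suc i)))"

definition normal_form :: "((nat \<Rightarrow> nat) \<Rightarrow> (nat \<Rightarrow> nat \<Rightarrow> nat) \<Rightarrow> bool) \<Rightarrow> bool" where
  "normal_form P \<longleftrightarrow> (\<exists>\<theta>. kernel \<theta> \<and> (\<forall>e s. P e s \<longleftrightarrow> (\<exists>w. \<forall>n. \<theta> n w e s)))"

lemma continuous_kernelD:
  "continuous_kernel \<theta> \<Longrightarrow> \<exists>N. \<forall>w' s'. (\<forall>i<N. w' i = w i) \<and> (\<forall>i<N. \<forall>j<N. s' i j = s i j) \<longrightarrow> \<theta> n w' e s' = \<theta> n w e s"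
  unfolding continuous_kernel_def by (elim allE)

section \<open>Closure of kernels and normal forms under the logical operations\<close>

lemma continuous_kernel_op:
  assumes "continuous_kernel \<theta>" "continuous_kernel \<eta>"
  shows "continuous_kernel (\<lambda>n w e s. f (\<theta> n w e s) (\<eta> n w e s))"
  unfolding continuous_kernel_def
proof (intro allI)
  fix n w e s
  obtain N1 where N1: "\<forall>w' s'. (\<forall>i<N1. w' i = w i) \<and> (\<forall>i<N1. \<forall>j<N1. s' i j = s i j) \<longrightarrow> \<theta> n w' e s' = \<theta> n w e s"
    using continuous_kernelD[OF assms(1)] ..
  obtain N2 where N2: "\<forall>w' s'. (\<forall>i<N2. w' i = w i) \<and> (\<forall>i<N2. \<forall>j<N2. s' i j = s i j) \<longrightarrow> \<eta> n w' e s' = \<eta> n w e s"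
    using continuous_kernelD[OF assms(2)] ..
  show "\<exists>N. \<forall>w' s'. (\<forall>i<N. w' i = w i) \<and> (\<forall>i<N. \<forall>j<N. s' i j = s i j) \<longrightarrow>
     f (\<theta> n w' e s') (\<eta> n w' e s') = f (\<theta> n w e s) (\<eta> n w e s)"
  proof (intro exI[of _ "N1 + N2"] allI impI)
    fix w' s' assume *: "(\<forall>i<N1+N2. w' i = w i) \<and> (\<forall>i<N1+N2. \<forall>j<N1+N2. s' i j = s i j)"
    have "\<theta> n w' e s' = \<theta> n w e s" by (rule N1[THEN spec, THEN spec, THEN mp]) (use * in auto)
    moreover have "\<eta> n w' e s' = \<eta> n w e s" by (rule N2[THEN spec, THEN spec, THEN mp]) (use * in auto)
    ultimately show "f (\<theta> n w' e s') (\<eta> n w' e s') = f (\<theta> n w e s) (\<eta> n w e s)" by simp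
  qed
qed

lemma kernel_conj: "kernel \<theta> \<Longrightarrow> kernel \<eta> \<Longrightarrow> kernel (\<lambda>n w e s. \<theta> n w e s \<and> \<eta> n w e s)"
  unfolding kernel_def using continuous_kernel_op[of \<theta> \<eta> "(\<and>)"] arpred_conj by auto

lemma kernel_disj: "kernel \<theta> \<Longrightarrow> kernel \<eta> \<Longrightarrow> kernel (\<lambda>n w e s. \<theta> n w e s \<or> \<eta> n w e s)"
  unfolding kernel_def using continuous_kernel_op[of \<theta> \<eta> "(\<or>)"] arpred_disj by auto

lemma kernel_not: "kernel \<theta> \<Longrightarrow> kernel (\<lambda>n w e s. \<not> \<theta> n w e s)"
  unfolding kernel_def using continuous_kernel_op[of \<theta> \<theta> "\<lambda>p q. \<not> p"] arpred_not by auto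

lemma kernel_head: "kernel (\<lambda>n w e s. w 0 = 0)"
proof -
  have "continuous_kernel (\<lambda>n w e s. w 0 = 0)"
    unfolding continuous_kernel_def by (intro allI exI[of _ 1]) simp
  moreover have "arpred (\<lambda>e s. s 0 0 = 0)" by (rule arpred_eq[OF arnum_app[OF arnum_const] arnum_const])
  ultimately show ?thesis unfolding kernel_def by blast
qed

text \<open>Each quantifier or binary connective repacks Skolem functions into one \<open>w\<close>:
  by parity, by a number stored in \<open>w 0\<close>, or by columns. All these are arithmetical
  re-readings \<open>r\<close> of \<open>w\<close>, together with an environment that looks at
  \<open>w 0\<close> only, so finitely many values still decide the kernel.\<close>

lemma kernel_reindex:
  assumes \<theta>: "kernel \<theta>"
    and a: "arnum (\<lambda>e s. a (e 0))" and r: "arnum (\<lambda>e s. r (e 0) (e 1))"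
    and E: "\<And>i. arnum (\<lambda>e s. E (e 0) (s 0 0) (\<lambda>i. e (Suc i)) i)"
  shows "kernel (\<lambda>n w e s. \<theta> (a n) (\<lambda>k. w (r n k)) (E n (w 0) e) s)"
  unfolding kernel_def
proof
  show "continuous_kernel (\<lambda>n w e s. \<theta> (a n) (\<lambda>k. w (r n k)) (E n (w 0) e) s)"
    unfolding continuous_kernel_def
  proof (intro allI)
    fix n w e s
    obtain N where N: "\<forall>w' s'. (\<forall>k<N. w' k = w (r n k)) \<and> (\<forall>i<N. \<forall>j<N. s' i j = s i j) \<longrightarrow>
      \<theta> (a n) w' (E n (w 0) e) s' = \<theta> (a n) (\<lambda>k. w (r n k)) (E n (w 0) e) s"
      using continuous_kernelD[OF conjunct1[OF \<theta>[unfolded kernel_def]]] ..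
    \<comment> \<open>\<open>M\<close> exceeds every position \<open>r n k\<close> with
      \<open>k < N\<close>, is at least \<open>N\<close> for the sake of \<open>s\<close>, and is
      positive so that \<open>w 0\<close> is fixed as well.\<close>
    define M where "M = Suc (N + (\<Sum>k<N. Suc (r n k)))"
    have M: "r n k < M" if "k < N" for k
    proof -
      have "Suc (r n k) \<le> (\<Sum>k<N. Suc (r n k))" using that by (intro member_le_sum) auto
      then show ?thesis unfolding M_def by simp
    qed
    show "\<exists>M. \<forall>w' s'. (\<forall>i<M. w' i = w i) \<and> (\<forall>i<M. \<forall>j<M. s' i j = s i j) \<longrightarrow>
      \<theta> (a n) (\<lambda>k. w' (r n k)) (E n (w' 0) e) s' = \<theta> (a n) (\<lambda>k. w (r n k)) (E n (w 0) e) s"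
    proof (intro exI[of _ M] allI impI)
      fix w' s' assume *: "(\<forall>i<M. w' i = w i) \<and> (\<forall>i<M. \<forall>j<M. s' i j = s i j)"
      then have "w' 0 = w 0" unfolding M_def by simp
      moreover have "\<theta> (a n) (\<lambda>k. w' (r n k)) (E n (w 0) e) s' = \<theta> (a n) (\<lambda>k. w (r n k)) (E n (w 0) e) s"
        by (rule N[THEN spec, THEN spec, THEN mp]) (use * M in \<open>auto simp: M_def\<close>)
      ultimately show "\<theta> (a n) (\<lambda>k. w' (r n k)) (E n (w' 0) e) s' = \<theta> (a n) (\<lambda>k. w (r n k)) (E n (w 0) e) s"
        by simp
    qed
  qed
  let ?F = "\<lambda>e s. case_nat (a (e 0)) (\<lambda>i. E (e 0) (s 0 0) (\<lambda>i. e (Suc i)) i)"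
  let ?G = "\<lambda>e s. case_nat (\<lambda>k. s 0 (r (e 0) k)) (\<lambda>i. s (Suc i))"
  have "arpred (\<lambda>e s. \<theta> (?F e s 0) (?G e s 0) (\<lambda>i. ?F e s (Suc i)) (\<lambda>i. ?G e s (Suc i)))"
  proof (rule arpred_subst[where F = ?F and G = ?G])
    show "arpred (\<lambda>e s. \<theta> (e 0) (s 0) (\<lambda>i. e (Suc i)) (\<lambda>i. s (Suc i)))"
      using \<theta> unfolding kernel_def by blast
    show "arnum (\<lambda>e s. ?F e s i)" for i by (cases i) (simp_all add: a E)
    show "arfun (\<lambda>e s. ?G e s i)" for i
    proof (cases i)
      case 0
      have "arnum (\<lambda>e s. r (e 1) (e 0))"
        using arnum_rename[OF r, of "\<lambda>i. if i = 0 then 1 else 0"] by simp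
      then have "arnum (\<lambda>e s. s 0 (r (e 1) (e 0)))" by (rule arnum_app)
      then show ?thesis using 0 by (simp add: arfun_def)
    qed (simp add: arfun_var)
  qed
  then show "arpred (\<lambda>e s. \<theta> (a (e 0)) (\<lambda>k. s 0 (r (e 0) k)) (E (e 0) (s 0 0) (\<lambda>i. e (Suc i))) (\<lambda>i. s (Suc i)))"
    by simp
qed

lemma normal_form_conj:
  assumes "normal_form P" "normal_form Q"
  shows "normal_form (\<lambda>e s. P e s \<and> Q e s)"
proof -
  obtain \<theta> where \<theta>: "kernel \<theta>" "\<And>e s. P e s \<longleftrightarrow> (\<exists>w. \<forall>n. \<theta> n w e s)" using assms(1) unfolding normal_form_def by auto
  obtain \<eta> where \<eta>: "kernel \<eta>" "\<And>e s. Q e s \<longleftrightarrow> (\<exists>w. \<forall>n. \<eta> n w e s)" using assms(2) unfolding normal_form_def by auto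
  have "kernel (\<lambda>n w e s. \<theta> n (\<lambda>k. w (2 * k)) e s \<and> \<eta> n (\<lambda>k. w (Suc (2 * k))) e s)"
    by (intro kernel_conj kernel_reindex[where a = "\<lambda>n. n" and E = "\<lambda>n m e. e" and r = "\<lambda>n k. 2 * k", OF \<theta>(1)]
         kernel_reindex[where a = "\<lambda>n. n" and E = "\<lambda>n m e. e" and r = "\<lambda>n k. Suc (2 * k)", OF \<eta>(1)]
         arnum_var arnum_mult arnum_Suc arnum_const)
  moreover have "(P e s \<and> Q e s) \<longleftrightarrow> (\<exists>w. \<forall>n. \<theta> n (\<lambda>k. w (2 * k)) e s \<and> \<eta> n (\<lambda>k. w (Suc (2 * k))) e s)" for e s
  proof
    assume "P e s \<and> Q e s"
    then obtain w w' where *: "\<And>n. \<theta> n w e s" "\<And>n. \<eta> n w' e s" using \<theta>(2) \<eta>(2) by blast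
    let ?w = "\<lambda>i. if even i then w (i div 2) else w' (i div 2)"
    have "(\<lambda>k. ?w (2 * k)) = w" "(\<lambda>k. ?w (Suc (2 * k))) = w'" by auto
    with * have "\<forall>n. \<theta> n (\<lambda>k. ?w (2 * k)) e s \<and> \<eta> n (\<lambda>k. ?w (Suc (2 * k))) e s" by presburger
    then show "\<exists>w. \<forall>n. \<theta> n (\<lambda>k. w (2 * k)) e s \<and> \<eta> n (\<lambda>k. w (Suc (2 * k))) e s" by (rule exI[of _ ?w])
  qed (use \<theta>(2) \<eta>(2) in blast)
  ultimately show ?thesis unfolding normal_form_def by blast
qed

lemma normal_form_disj:
  assumes "normal_form P" "normal_form Q"
  shows "normal_form (\<lambda>e s. P e s \<or> Q e s)"
proof -
  obtain \<theta> where \<theta>: "kernel \<theta>" "\<And>e s. P e s \<longleftrightarrow> (\<exists>w. \<forall>n. \<theta> n w e s)" using assms(1) unfolding normal_form_def by auto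
  obtain \<eta> where \<eta>: "kernel \<eta>" "\<And>e s. Q e s \<longleftrightarrow> (\<exists>w. \<forall>n. \<eta> n w e s)" using assms(2) unfolding normal_form_def by auto
  \<comment> \<open>The entry \<open>w 0\<close> chooses the disjunct once for all \<open>n\<close>;
    a disjunction taken separately at each \<open>n\<close> would be too weak.\<close>
  let ?\<zeta> = "\<lambda>n w e s. (w 0 = 0 \<and> \<theta> n (\<lambda>k. w (Suc k)) e s) \<or> (\<not> w 0 = 0 \<and> \<eta> n (\<lambda>k. w (Suc k)) e s)"
  have "kernel ?\<zeta>"
    by (intro kernel_conj kernel_disj kernel_not kernel_head
        kernel_reindex[where a = "\<lambda>n. n" and E = "\<lambda>n m e. e" and r = "\<lambda>n k. Suc k", OF \<theta>(1)]
         kernel_reindex[where a = "\<lambda>n. n" and E = "\<lambda>n m e. e" and r = "\<lambda>n k. Suc k", OF \<eta>(1)]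
         arnum_var arnum_mult arnum_Suc arnum_const)
  moreover have "(P e s \<or> Q e s) \<longleftrightarrow> (\<exists>w. \<forall>n. ?\<zeta> n w e s)" for e s
  proof
    assume "P e s \<or> Q e s"
    then consider w where "\<And>n. \<theta> n w e s" | w where "\<And>n. \<eta> n w e s" using \<theta>(2) \<eta>(2) by blast
    then show "\<exists>w. \<forall>n. ?\<zeta> n w e s"
    proof cases
      case 1 then show ?thesis by (intro exI[of _ "case_nat 0 w"]) simp
    next
      case 2 then show ?thesis by (intro exI[of _ "case_nat 1 w"]) simp
    qed
  qed (use \<theta>(2) \<eta>(2) in blast)
  ultimately show ?thesis unfolding normal_form_def by blast
qed

lemma arnum_update: "arnum (\<lambda>e s. ((\<lambda>i. e (Suc i))(j := h e s)) i)" if "arnum h"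
  using that by (cases "i = j") (simp_all add: arnum_var)

lemma normal_form_ex:
  assumes "normal_form P"
  shows "normal_form (\<lambda>e s. \<exists>m. P (e(i := m)) s)"
proof -
  obtain \<theta> where \<theta>: "kernel \<theta>" "\<And>e s. P e s \<longleftrightarrow> (\<exists>w. \<forall>n. \<theta> n w e s)" using assms(1) unfolding normal_form_def by auto
  let ?\<zeta> = "\<lambda>n w e s. \<theta> n (\<lambda>k. w (Suc k)) (e(i := w 0)) s"
  have "kernel ?\<zeta>"
    by (intro kernel_reindex[where a = "\<lambda>n. n" and E = "\<lambda>n m e. e(i := m)" and r = "\<lambda>n k. Suc k", OF \<theta>(1)]
         arnum_update arnum_app arnum_var arnum_Suc arnum_const)
  moreover have "(\<exists>m. P (e(i := m)) s) \<longleftrightarrow> (\<exists>w. \<forall>n. ?\<zeta> n w e s)" for e s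
  proof
    assume "\<exists>m. P (e(i := m)) s"
    then obtain m w where "\<And>n. \<theta> n w (e(i := m)) s" using \<theta>(2) by blast
    then show "\<exists>w. \<forall>n. ?\<zeta> n w e s" by (intro exI[of _ "case_nat m w"]) simp
  qed (use \<theta>(2) in blast)
  ultimately show ?thesis unfolding normal_form_def by blast
qed

text \<open>Countable choice gives a Skolem function for every \<open>m\<close>; they become the
  columns of a single \<open>w\<close>, and the two universal number quantifiers contract to one
  over pairs.\<close>

lemma normal_form_all:
  assumes "normal_form P"
  shows "normal_form (\<lambda>e s. \<forall>m. P (e(i := m)) s)"
proof -
  obtain \<theta> where \<theta>: "kernel \<theta>" "\<And>e s. P e s \<longleftrightarrow> (\<exists>w. \<forall>n. \<theta> n w e s)" using assms(1) unfolding normal_form_def by auto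
  let ?\<zeta> = "\<lambda>n w e s. \<theta> (snd (prod_decode n)) (\<lambda>k. w (prod_encode (fst (prod_decode n), k)))
    (e(i := fst (prod_decode n))) s"
  have "kernel ?\<zeta>"
    by (intro kernel_reindex[where a = "\<lambda>n. snd (prod_decode n)" and E = "\<lambda>n m e. e(i := fst (prod_decode n))"
          and r = "\<lambda>n k. prod_encode (fst (prod_decode n), k)", OF \<theta>(1)]
         arnum_update arnum_app arnum_var arnum_prod_encode arnum_snd_prod_decode arnum_fst_prod_decode)
  moreover have "(\<forall>m. P (e(i := m)) s) \<longleftrightarrow> (\<exists>w. \<forall>n. ?\<zeta> n w e s)" for e s
  proof
    assume "\<forall>m. P (e(i := m)) s"
    then obtain W where "\<And>m n. \<theta> n (W m) (e(i := m)) s" unfolding \<theta>(2) by metis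
    then show "\<exists>w. \<forall>n. ?\<zeta> n w e s"
      by (intro exI[of _ "\<lambda>k. W (fst (prod_decode k)) (snd (prod_decode k))"]) simp
  next
    assume "\<exists>w. \<forall>n. ?\<zeta> n w e s"
    then obtain w where w: "\<And>n. ?\<zeta> n w e s" by blast
    show "\<forall>m. P (e(i := m)) s" unfolding \<theta>(2)
    proof (intro allI exI)
      fix m n
      show "\<theta> n (\<lambda>k. w (prod_encode (m, k))) (e(i := m)) s" using w[of "prod_encode (m, n)"] by simp
    qed
  qed
  ultimately show ?thesis unfolding normal_form_def by blast
qed

lemma tm_val_continuous: "\<exists>N. \<forall>s'. (\<forall>i<N. \<forall>j<N. s' i j = s i j) \<longrightarrow> tm_val e s' t = tm_val e s t"
proof (induction t)
  case (Add t u)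
  from Add.IH(1) obtain N where N: "\<forall>s'. (\<forall>i<N. \<forall>j<N. s' i j = s i j) \<longrightarrow> tm_val e s' t = tm_val e s t" ..
  from Add.IH(2) obtain M where M: "\<forall>s'. (\<forall>i<M. \<forall>j<M. s' i j = s i j) \<longrightarrow> tm_val e s' u = tm_val e s u" ..
  show ?case
  proof (intro exI[of _ "N + M"] allI impI)
    fix s' assume *: "\<forall>i<N+M. \<forall>j<N+M. s' i j = s i j"
    have "tm_val e s' t = tm_val e s t" by (rule N[THEN spec, THEN mp]) (use * in auto)
    moreover have "tm_val e s' u = tm_val e s u" by (rule M[THEN spec, THEN mp]) (use * in auto)
    ultimately show "tm_val e s' (Add t u) = tm_val e s (Add t u)" by simp
  qed
next
  case (Mul t u)
  from Mul.IH(1) obtain N where N: "\<forall>s'. (\<forall>i<N. \<forall>j<N. s' i j = s i j) \<longrightarrow> tm_val e s' t = tm_val e s t" ..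
  from Mul.IH(2) obtain M where M: "\<forall>s'. (\<forall>i<M. \<forall>j<M. s' i j = s i j) \<longrightarrow> tm_val e s' u = tm_val e s u" ..
  show ?case
  proof (intro exI[of _ "N + M"] allI impI)
    fix s' assume *: "\<forall>i<N+M. \<forall>j<N+M. s' i j = s i j"
    have "tm_val e s' t = tm_val e s t" by (rule N[THEN spec, THEN mp]) (use * in auto)
    moreover have "tm_val e s' u = tm_val e s u" by (rule M[THEN spec, THEN mp]) (use * in auto)
    ultimately show "tm_val e s' (Mul t u) = tm_val e s (Mul t u)" by simp
  qed
next
  case (App i t)
  from App.IH obtain N where N: "\<forall>s'. (\<forall>i<N. \<forall>j<N. s' i j = s i j) \<longrightarrow> tm_val e s' t = tm_val e s t" ..
  show ?case
  proof (intro exI[of _ "Suc (N + i + tm_val e s t)"] allI impI)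
    fix s' assume *: "\<forall>k<Suc (N + i + tm_val e s t). \<forall>j<Suc (N + i + tm_val e s t). s' k j = s k j"
    have "tm_val e s' t = tm_val e s t" by (rule N[THEN spec, THEN mp]) (use * in auto)
    with * show "tm_val e s' (App i t) = tm_val e s (App i t)" by simp
  qed
qed auto

lemma kernel_atom:
  assumes "arpred (\<lambda>e s. P (tm_val e s t) (tm_val e s u))"
  shows "kernel (\<lambda>n w e s. P (tm_val e s t) (tm_val e s u))"
  unfolding kernel_def
proof
  show "continuous_kernel (\<lambda>n w e s. P (tm_val e s t) (tm_val e s u))"
    unfolding continuous_kernel_def
  proof (intro allI)
    fix e s
    obtain N where N: "\<forall>s'. (\<forall>i<N. \<forall>j<N. s' i j = s i j) \<longrightarrow> tm_val e s' t = tm_val e s t"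
      using tm_val_continuous ..
    obtain M where M: "\<forall>s'. (\<forall>i<M. \<forall>j<M. s' i j = s i j) \<longrightarrow> tm_val e s' u = tm_val e s u"
      using tm_val_continuous ..
    show "\<exists>N. \<forall>w' s'. (\<forall>i<N. w' i = w i) \<and> (\<forall>i<N. \<forall>j<N. s' i j = s i j) \<longrightarrow>
      P (tm_val e s' t) (tm_val e s' u) = P (tm_val e s t) (tm_val e s u)" for w :: "nat \<Rightarrow> nat"
    proof (intro exI[of _ "N + M"] allI impI, elim conjE)
      fix s' assume *: "\<forall>i<N+M. \<forall>j<N+M. s' i j = s i j"
      have "tm_val e s' t = tm_val e s t" by (rule N[THEN spec, THEN mp]) (use * in auto)
      moreover have "tm_val e s' u = tm_val e s u" by (rule M[THEN spec, THEN mp]) (use * in auto)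
      ultimately show "P (tm_val e s' t) (tm_val e s' u) = P (tm_val e s t) (tm_val e s u)" by simp
    qed
  qed
  show "arpred (\<lambda>e s. P (tm_val (\<lambda>i. e (Suc i)) (\<lambda>i. s (Suc i)) t) (tm_val (\<lambda>i. e (Suc i)) (\<lambda>i. s (Suc i)) u))"
    by (rule arpred_subst[OF assms]) (intro arnum_var arfun_var)+
qed

lemma normal_form_kernel: "kernel (\<lambda>n w. P) \<Longrightarrow> normal_form P"
  unfolding normal_form_def by (intro exI[of _ "\<lambda>n w. P"]) simp

text \<open>Both polarities are proved together, so that the induction passes through
  \<open>Neg\<close>.\<close>

lemma normal_form_holds:
  "arithmetical \<phi> \<Longrightarrow> normal_form (\<lambda>e s. holds e s \<phi>) \<and> normal_form (\<lambda>e s. \<not> holds e s \<phi>)"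
proof (induction \<phi>)
  case (Eq t u)
  have "kernel (\<lambda>n w e s. tm_val e s t = tm_val e s u)"
    by (rule kernel_atom) (use arpred_holds[of "Eq t u"] in simp)
  then show ?case using kernel_not by (auto intro: normal_form_kernel)
next
  case (Less t u)
  have "kernel (\<lambda>n w e s. tm_val e s t < tm_val e s u)"
    by (rule kernel_atom[where P = "(<)"]) (use arpred_holds[of "Less t u"] in simp)
  then show ?case using kernel_not[of "\<lambda>n w e s. tm_val e s t < tm_val e s u"] by (auto intro!: normal_form_kernel)
next
  case (Conj \<phi> \<psi>)
  then show ?case
    by (simp only: arithmetical.simps holds.simps de_Morgan_conj normal_form_conj normal_form_disj simp_thms)
next
  case (Disj \<phi> \<psi>)
  then show ?case
    by (simp only: arithmetical.simps holds.simps de_Morgan_disj normal_form_conj normal_form_disj simp_thms)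
next
  case (AllN i \<phi>)
  then show ?case
    using normal_form_all[of "\<lambda>e s. holds e s \<phi>" i] normal_form_ex[of "\<lambda>e s. \<not> holds e s \<phi>" i] by simp
next
  case (ExN i \<phi>)
  then show ?case
    using normal_form_ex[of "\<lambda>e s. holds e s \<phi>" i] normal_form_all[of "\<lambda>e s. \<not> holds e s \<phi>" i] by simp
qed simp_all

text \<open>
  Nodes are pairs of a length and a \<open>beta\<close>-code, so a finite sequence has many nodes. Asking only
  for some extensions \<open>q\<close>, \<open>r\<close> satisfying \<open>\<theta>\<close> keeps the edges decided by finitely many
  values of \<open>y\<close>.
\<close>

definition tree :: "(nat \<Rightarrow> (nat \<Rightarrow> nat) \<Rightarrow> (nat \<Rightarrow> nat) \<Rightarrow> bool) \<Rightarrow> (nat \<Rightarrow> nat) \<Rightarrow> nat \<Rightarrow> nat \<Rightarrow> bool" where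
  "tree \<theta> y m n \<longleftrightarrow>
     fst (prod_decode n) < fst (prod_decode m) \<and>
     (\<forall>i<fst (prod_decode n). beta (snd (prod_decode m)) i = beta (snd (prod_decode n)) i) \<and>
     (\<forall>k<fst (prod_decode m). \<exists>q r.
        (\<forall>i<fst (prod_decode m). beta q i = beta (snd (prod_decode m)) i) \<and>
        (\<forall>i<fst (prod_decode m). beta r i = y i) \<and> \<theta> k (beta q) (beta r))"

lemma tree_continuous: "tree \<theta> y m n \<Longrightarrow> \<exists>N. \<forall>z. (\<forall>i<N. z i = y i) \<longrightarrow> tree \<theta> z m n"
  unfolding tree_def by (intro exI[of _ "fst (prod_decode m)"]) simp

text \<open>Number \<open>0\<close> codes length zero, and edges join a node to any shorter initial
  segment rather than only to the next one. So every node with an outgoing edge lies directly below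
  the root \<open>0\<close>.\<close>

lemma tree_root: "tree \<theta> y m n \<Longrightarrow> tree \<theta> y m 0"
proof -
  have "fst (prod_decode 0) = 0" by (simp add: prod_decode_def prod_decode_aux.simps)
  then show "tree \<theta> y m n \<Longrightarrow> tree \<theta> y m 0" unfolding tree_def by auto
qed

lemma wfp_tree:
  assumes cont: "\<And>n v y. \<exists>N. \<forall>v' y'. (\<forall>i<N. v' i = v i) \<and> (\<forall>i<N. y' i = y i) \<longrightarrow> \<theta> n v' y' = \<theta> n v y"
  shows "wfp (tree \<theta> y) \<longleftrightarrow> (\<forall>v. \<exists>n. \<not> \<theta> n v y)"
proof
  assume wf: "wfp (tree \<theta> y)"
  show "\<forall>v. \<exists>n. \<not> \<theta> n v y"
  proof (rule ccontr)
    assume "\<not> (\<forall>v. \<exists>n. \<not> \<theta> n v y)"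
    then obtain v where v: "\<And>n. \<theta> n v y" by blast
    obtain p where p: "\<And>N i. i < N \<Longrightarrow> beta (p N) i = v i" using beta_surj[of _ v] by metis
    have "tree \<theta> y (prod_encode (Suc N, p (Suc N))) (prod_encode (N, p N))" for N
      unfolding tree_def prod_encode_inverse fst_conv snd_conv
    proof (intro conjI allI impI)
      fix k assume "k < Suc N"
      obtain K where K: "\<forall>v' y'. (\<forall>i<K. v' i = v i) \<and> (\<forall>i<K. y' i = y i) \<longrightarrow> \<theta> k v' y' = \<theta> k v y"
        using cont ..
      \<comment> \<open>Codes of length \<open>Suc N + K\<close> both extend the node and, by
        continuity, force \<theta> at \<open>k\<close>.\<close>
      obtain r where r: "\<And>i. i < Suc N + K \<Longrightarrow> beta r i = y i" using beta_surj[of _ y] by metis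
      have "\<theta> k (beta (p (Suc N + K))) (beta r)" using K[THEN spec, THEN spec, of "beta (p (Suc N + K))" "beta r"] v p r by simp
      then show "\<exists>q r. (\<forall>i<Suc N. beta q i = beta (p (Suc N)) i) \<and> (\<forall>i<Suc N. beta r i = y i) \<and> \<theta> k (beta q) (beta r)"
        using p r by (intro exI[of _ "p (Suc N + K)"] exI[of _ r]) simp
    qed (simp_all add: p)
    then have "\<exists>f. \<forall>N. (f (Suc N), f N) \<in> {(m, n). tree \<theta> y m n}"
      by (intro exI[of _ "\<lambda>N. prod_encode (N, p N)"]) simp
    then show False using wf unfolding wfp_def wf_iff_no_infinite_down_chain by simp
  qed
next
  assume nobranch: "\<forall>v. \<exists>n. \<not> \<theta> n v y"
  show "wfp (tree \<theta> y)"
    unfolding wfp_def wf_iff_no_infinite_down_chain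
  proof
    assume "\<exists>f. \<forall>i. (f (Suc i), f i) \<in> {(x, z). tree \<theta> y x z}"
    then obtain f where f: "\<And>k. tree \<theta> y (f (Suc k)) (f k)" by auto
    define N where "N k = fst (prod_decode (f k))" for k
    define p where "p k = snd (prod_decode (f k))" for k
    have N: "N k < N (Suc k)" and p: "i < N k \<Longrightarrow> beta (p (Suc k)) i = beta (p k) i"
      and \<theta>: "j < N (Suc k) \<Longrightarrow> \<exists>q r. (\<forall>i<N (Suc k). beta q i = beta (p (Suc k)) i) \<and>
        (\<forall>i<N (Suc k). beta r i = y i) \<and> \<theta> j (beta q) (beta r)" for i j k
      using f[of k] unfolding tree_def N_def p_def by auto
    have mono: "strict_mono N" using N by (simp add: strict_mono_Suc_iff)
    have Nk: "k \<le> N k" for k using mono by (rule strict_mono_imp_increasing)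
    have p': "beta (p l) i = beta (p k) i" if "k \<le> l" "i < N k" for i k l
      using that(1)
    proof (induction rule: dec_induct)
      case (step l)
      have "i < N l" using that(2) step.hyps(1) mono by (meson order.strict_trans2 strict_mono_less_eq)
      then show ?case using p step.IH by simp
    qed simp
    \<comment> \<open>The node \<open>f (Suc i)\<close> has length above \<open>i\<close>, so its
      entry at \<open>i\<close> is already final.\<close>
    define v where "v i = beta (p (Suc i)) i" for i
    have v: "beta (p k) i = v i" if "i < N k" for i k
      unfolding v_def using p'[of k "Suc i" i] p'[of "Suc i" k i] that Nk[of "Suc i"] by (cases "k \<le> Suc i") auto
    have "\<theta> k v y" for k
    proof -
      obtain K where K: "\<forall>v' y'. (\<forall>i<K. v' i = v i) \<and> (\<forall>i<K. y' i = y i) \<longrightarrow> \<theta> k v' y' = \<theta> k v y"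
        using cont ..
      \<comment> \<open>Length above \<open>k\<close> means that the node tests \<theta> at
        \<open>k\<close>; length at least \<open>K\<close> means that the test transfers to the
        limit \<open>v\<close> and to \<open>y\<close>.\<close>
      have M: "k < N (Suc (k + K))" "K \<le> N (Suc (k + K))" using Nk[of "Suc (k + K)"] by auto
      obtain q r where "\<forall>i<N (Suc (k + K)). beta q i = beta (p (Suc (k + K))) i"
        "\<forall>i<N (Suc (k + K)). beta r i = y i" "\<theta> k (beta q) (beta r)"
        using \<theta>[OF M(1)] by blast
      then show ?thesis using K[THEN spec, THEN spec, of "beta q" "beta r"] v M(2) by simp
    qed
    with nobranch show False by blast
  qed
qed

section \<open>Uniformization\<close>

definition sim :: "('a \<Rightarrow> 'a \<Rightarrow> bool) \<Rightarrow> ('b \<Rightarrow> 'b \<Rightarrow> bool) \<Rightarrow> ('a \<Rightarrow> 'b \<Rightarrow> bool) \<Rightarrow> bool" where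
  "sim R S Z \<longleftrightarrow> (\<forall>a b. Z a b \<longrightarrow> (\<forall>a'. R a' a \<longrightarrow> (\<exists>b'. S b' b \<and> Z a' b')))"

text \<open>
  On well-founded relations \<open>rle R a S b\<close> says that the rank of \<open>a\<close> is at most the rank of \<open>b\<close>.
\<close>

definition rle :: "('a \<Rightarrow> 'a \<Rightarrow> bool) \<Rightarrow> 'a \<Rightarrow> ('b \<Rightarrow> 'b \<Rightarrow> bool) \<Rightarrow> 'b \<Rightarrow> bool" where
  "rle R a S b \<longleftrightarrow> (\<exists>Z. sim R S Z \<and> Z a b)"

definition rlt :: "('a \<Rightarrow> 'a \<Rightarrow> bool) \<Rightarrow> 'a \<Rightarrow> ('b \<Rightarrow> 'b \<Rightarrow> bool) \<Rightarrow> 'b \<Rightarrow> bool" where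
  "rlt R a S b \<longleftrightarrow> (\<exists>b'. S b' b \<and> rle R a S b')"

lemma sim_rle: "sim R S (\<lambda>a b. rle R a S b)"
  unfolding sim_def
proof (intro allI impI)
  fix a b a' assume "rle R a S b" "R a' a"
  then obtain Z where Z: "sim R S Z" "Z a b" unfolding rle_def by blast
  with \<open>R a' a\<close> obtain b' where "S b' b" "Z a' b'" unfolding sim_def by blast
  with Z(1) show "\<exists>b'. S b' b \<and> rle R a' S b'" unfolding rle_def by blast
qed

lemma rleD: "rle R a S b \<Longrightarrow> R a' a \<Longrightarrow> rlt R a' S b"
  using sim_rle[of R S] unfolding rlt_def sim_def by blast

lemma rleI:
  assumes "\<And>a'. R a' a \<Longrightarrow> rlt R a' S b"
  shows "rle R a S b"
proof -
  let ?Z = "\<lambda>x y. rle R x S y \<or> (x = a \<and> y = b)"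
  have "sim R S ?Z"
    unfolding sim_def using assms rleD[of R _ S] unfolding rlt_def by blast
  then show ?thesis unfolding rle_def[of R a S b] by (intro exI[of _ ?Z]) simp
qed

lemma rle_refl: "rle R a R a"
  unfolding rle_def sim_def by (rule exI[of _ "(=)"]) auto

lemma rle_trans:
  assumes "rle R a S b" "rle S b T c"
  shows "rle R a T c"
proof -
  have "sim R T (\<lambda>x z. \<exists>y. rle R x S y \<and> rle S y T z)"
    unfolding sim_def
  proof (intro allI impI, elim exE conjE)
    fix a c a' b assume "rle R a S b" "rle S b T c" "R a' a"
    then obtain b' where b': "S b' b" "rle R a' S b'"
      using sim_rle[of R S] unfolding sim_def by blast
    with \<open>rle S b T c\<close> obtain c' where "T c' c" "rle S b' T c'"
      using sim_rle[of S T] unfolding sim_def by blast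
    with b' show "\<exists>c'. T c' c \<and> (\<exists>b. rle R a' S b \<and> rle S b T c')" by blast
  qed
  with assms show ?thesis unfolding rle_def[of R a T c] by blast
qed

lemma rle_rlt_trans: "rle R a S b \<Longrightarrow> rlt S b T c \<Longrightarrow> rlt R a T c"
  unfolding rlt_def by (metis rle_trans)

lemma rlt_rle_trans: "rlt R a S b \<Longrightarrow> rle S b T c \<Longrightarrow> rlt R a T c"
  using rleD rle_rlt_trans unfolding rlt_def[of R a S b] by metis

lemma rlt_imp_rle:
  assumes "wfp S"
  shows "rlt R a S b \<Longrightarrow> rle R a S b"
  using assms
proof (induction b arbitrary: a rule: wfp_induct_rule)
  case (less b)
  then obtain b' where b': "S b' b" "rle R a S b'" unfolding rlt_def by blast
  show ?case
  proof (rule rleI)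
    fix a' assume "R a' a"
    then have "rlt R a' S b'" using b'(2) rleD by metis
    then show "rlt R a' S b" using less.IH b'(1) unfolding rlt_def[of R a' S b] by blast
  qed
qed

lemma rlt_irrefl:
  assumes "wfp S"
  shows "\<not> rlt S b S b"
  using assms
proof (induction b rule: wfp_induct_rule)
  case (less b)
  show ?case
  proof
    assume "rlt S b S b"
    then obtain b' where "S b' b" "rle S b S b'" unfolding rlt_def by blast
    then show False using less.IH[of b'] rleD[of S b S b' b'] by blast
  qed
qed

text \<open>If \<open>a\<close> is not simulated at \<open>b\<close>, then by \<open>rleI\<close>
  some predecessor \<open>a'\<close> is not strictly below \<open>b\<close>. By induction every
  predecessor of \<open>b\<close> is then strictly below \<open>a'\<close>, which places
  \<open>b\<close> at or below \<open>a'\<close>, hence strictly below \<open>a\<close>.\<close>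

lemma rle_or_rlt:
  assumes "wfp R"
  shows "rle R a S b \<or> rlt S b R a"
  using assms
proof (induction a arbitrary: b rule: wfp_induct_rule)
  case (less a)
  show ?case
  proof (cases "rle R a S b")
    case False
    then obtain a' where a': "R a' a" "\<not> rlt R a' S b" using rleI by metis
    have "rle S b R a'"
      by (rule rleI) (use less.IH[OF a'(1)] a'(2) in \<open>auto simp: rlt_def\<close>)
    with a'(1) show ?thesis unfolding rlt_def by blast
  qed simp
qed

text \<open>This replaces the well-ordering of ordinals: ranks taken in different trees admit no
  infinite descent. Accessibility is proved by induction on a bounding node \<open>b\<close>, for
  all pairs of rank at most that of \<open>b\<close>.\<close>

lemma wf_rlt: "wf {((Q, c), (R, a)). wfp Q \<and> wfp R \<and> rlt Q c R a}" (is "wf ?L")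
proof -
  have *: "(R, a) \<in> Wellfounded.acc ?L" if "wfp S" "rle R a S b" for R S :: "'a \<Rightarrow> 'a \<Rightarrow> bool" and a b
    using that
  proof (induction b arbitrary: R a rule: wfp_induct_rule)
    case (less b)
    show ?case
    proof (rule accI, clarify)
      fix Q :: "'a \<Rightarrow> 'a \<Rightarrow> bool" and c assume "rlt Q c R a"
      then have "rlt Q c S b" using less.prems by (rule rlt_rle_trans)
      then show "(Q, c) \<in> Wellfounded.acc ?L" using less.IH unfolding rlt_def by blast
    qed
  qed
  then have "(R, a) \<in> Wellfounded.acc ?L" for R a
    using *[OF _ rle_refl] by (cases "wfp R") (blast, auto intro: accI)
  then show ?thesis by (intro acc_wfI) auto
qed

lemma rle_accp:
  assumes "wfp S"
  shows "rle R a S b \<Longrightarrow> Wellfounded.accp R a"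
  using assms
proof (induction b arbitrary: a rule: wfp_induct_rule)
  case (less b)
  show ?case
    by (rule accp.accI) (use rleD[OF less.prems] less.IH in \<open>auto simp: rlt_def\<close>)
qed

text \<open>Earlier ranks are compared in one direction only. When \<open>R y\<close> is
  well-founded, a strict drop among them would itself be a \<open>lex_below\<close> at that index,
  and the one-sided form uses only simulations of \<open>R z\<close> in \<open>R y\<close>, which
  one existential function can code.\<close>

definition lex_below :: "((nat \<Rightarrow> nat) \<Rightarrow> nat \<Rightarrow> nat \<Rightarrow> bool) \<Rightarrow> (nat \<Rightarrow> nat) \<Rightarrow> (nat \<Rightarrow> nat) \<Rightarrow> nat \<Rightarrow> bool" where
  "lex_below R z y n \<longleftrightarrow>
     (\<forall>i<n. rle (R z) i (R y) i \<and> z i = y i) \<and>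
     (rlt (R z) n (R y) n \<or> rle (R z) n (R y) n \<and> z n < y n)"

definition lex_least :: "((nat \<Rightarrow> nat) \<Rightarrow> nat \<Rightarrow> nat \<Rightarrow> bool) \<Rightarrow> (nat \<Rightarrow> nat) \<Rightarrow> bool" where
  "lex_least R y \<longleftrightarrow> wfp (R y) \<and> (\<forall>z n. \<not> lex_below R z y n)"

lemma lex_least_unique:
  assumes "lex_least R y" "lex_least R z"
  shows "y = z"
proof (rule ccontr)
  assume "y \<noteq> z"
  let ?E = "\<lambda>n. rle (R y) n (R z) n \<and> rle (R z) n (R y) n \<and> y n = z n"
  define n where "n = (LEAST n. \<not> ?E n)"
  have "\<exists>n. \<not> ?E n" using \<open>y \<noteq> z\<close> by auto
  then have n: "\<not> ?E n" unfolding n_def by (metis (mono_tags, lifting) LeastI_ex)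
  have less: "?E i" if "i < n" for i
    using not_less_Least that unfolding n_def by blast
  have wf: "wfp (R y)" "wfp (R z)" using assms unfolding lex_least_def by auto
  have "lex_below R y z n \<or> lex_below R z y n"
    using n less rle_or_rlt[OF wf(1), of n "R z" n] rle_or_rlt[OF wf(2), of n "R y" n]
    unfolding lex_below_def by (metis linorder_neqE_nat)
  then show False using assms unfolding lex_least_def by blast
qed

text \<open>
  Stage \<open>Suc n\<close> keeps the members of stage \<open>n\<close> with least rank of node \<open>n\<close> and, among these, least
  value at \<open>n\<close>. The values stabilize to the uniformizing \<open>y\<close>; its nodes have ranks bounded by the
  stabilized ranks, so \<open>R y\<close> is again well-founded.
\<close>

primrec stage :: "((nat \<Rightarrow> nat) \<Rightarrow> nat \<Rightarrow> nat \<Rightarrow> bool) \<Rightarrow> nat \<Rightarrow> (nat \<Rightarrow> nat) set" where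
  "stage R 0 = {y. wfp (R y)}"
| "stage R (Suc n) = {y \<in> stage R n. \<forall>z \<in> stage R n.
     rle (R y) n (R z) n \<and> (rle (R z) n (R y) n \<longrightarrow> y n \<le> z n)}"

lemma stage_antimono: "m \<le> n \<Longrightarrow> stage R n \<subseteq> stage R m"
  by (induction n) (auto simp: le_Suc_eq)

lemma stage_wfp: "y \<in> stage R n \<Longrightarrow> wfp (R y)"
  using stage_antimono[of 0 n R] by auto

lemma stage_nonempty:
  assumes "wfp (R y)"
  shows "stage R n \<noteq> {}"
proof (induction n)
  case (Suc n)
  let ?L = "{((Q, c), (R, a)). wfp Q \<and> wfp R \<and> rlt Q c R a}"
  have "wf (inv_image ?L (\<lambda>y. (R y, n)))" by (rule wf_inv_image[OF wf_rlt])
  then obtain y0 where y0: "y0 \<in> stage R n"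
    "\<And>z. (z, y0) \<in> inv_image ?L (\<lambda>y. (R y, n)) \<Longrightarrow> z \<notin> stage R n"
    using wfE_min'[of _ "stage R n"] Suc by blast
  have y0': "\<not> rlt (R z) n (R y0) n" if "z \<in> stage R n" for z
    using y0(2)[of z] that y0(1) stage_wfp by (auto simp: inv_image_def)
  let ?B = "\<lambda>y. y \<in> stage R n \<and> rle (R y) n (R y0) n"
  have "?B y0" using y0 rle_refl by auto
  then obtain y where y: "?B y" "\<And>z. ?B z \<Longrightarrow> y n \<le> z n"
    using ex_has_least_nat[of ?B y0 "\<lambda>y. y n"] by blast
  have "y \<in> stage R (Suc n)"
    unfolding stage.simps
  proof (intro CollectI conjI ballI impI)
    fix z assume z: "z \<in> stage R n"
    have "rle (R y0) n (R z) n"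
      using rle_or_rlt[OF stage_wfp[OF y0(1)], of n "R z" n] y0'[OF z] by blast
    then show "rle (R y) n (R z) n" using y(1) rle_trans by metis
    assume "rle (R z) n (R y) n"
    then have "?B z" using z y(1) rle_trans by metis
    then show "y n \<le> z n" by (rule y)
  qed (use y in blast)
  then show ?case by blast
qed (use assms in auto)

theorem lex_least_exists:
  assumes cont: "\<And>y m n. R y m n \<Longrightarrow> \<exists>N. \<forall>z. (\<forall>i<N. z i = y i) \<longrightarrow> R z m n"
    and root: "\<And>y m n. R y m n \<Longrightarrow> R y m 0"
    and "wfp (R y0)"
  shows "\<exists>y. lex_least R y"
proof -
  have "\<forall>n. \<exists>z. z \<in> stage R (Suc n)" using stage_nonempty[of R y0] assms(3) by blast
  then obtain z where z: "\<And>n. z n \<in> stage R (Suc n)" by metis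
  \<comment> \<open>Members of stage \<open>Suc n\<close> all share their value at \<open>n\<close>,
    so this diagonal does not depend on the choice of the \<open>z n\<close>.\<close>
  define y where "y n = z n n" for n
  have eq: "rle (R w) i (R (z i)) i" "rle (R (z i)) i (R w) i" "w i = y i"
    if "w \<in> stage R m" "i < m" for w i m
  proof -
    have w: "w \<in> stage R (Suc i)" using that stage_antimono[of "Suc i" m R] by auto
    with z[of i] show 1: "rle (R w) i (R (z i)) i" "rle (R (z i)) i (R w) i" by auto
    with w z[of i] show "w i = y i" unfolding y_def by (simp add: dual_order.antisym)
  qed
  have edge: "rlt (R (z m)) m (R (z n)) n" if e: "R y m n" for m n
  proof -
    obtain N where N: "\<And>w. (\<forall>i<N. w i = y i) \<Longrightarrow> R w m n" using cont[OF e] by blast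
    \<comment> \<open>Beyond \<open>N\<close> the function \<open>z M\<close> agrees with
      \<open>y\<close> far enough to have the edge; beyond \<open>m\<close> and \<open>n\<close> its
      ranks at these nodes are the stabilized ones.\<close>
    define M where "M = N + m + n"
    have "R (z M) m n" by (rule N) (use eq(3)[OF z[of M]] M_def in auto)
    then have lt: "rlt (R (z M)) m (R (z M)) n" unfolding rlt_def by (intro exI[of _ m] conjI rle_refl)
    have le: "rle (R (z m)) m (R (z M)) m" "rle (R (z M)) n (R (z n)) n"
      using eq[OF z[of M]] M_def by auto
    show ?thesis by (rule rlt_rle_trans[OF rle_rlt_trans[OF le(1) lt] le(2)])
  qed
  have wfz: "wfp (R (z n))" for n using stage_wfp[OF z] .
  \<comment> \<open>By \<open>edge\<close>, sending \<open>n\<close> to the pair of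
    \<open>R (z n)\<close> and \<open>n\<close> embeds \<open>R y\<close> into the rank comparison
    of \<open>wf_rlt\<close>.\<close>
  have wfy: "wfp (R y)"
    unfolding wfp_def
    by (rule wf_subset[OF wf_inv_image[OF wf_rlt, of "\<lambda>n. (R (z n), n)"]])
      (auto simp: inv_image_def wfz edge)
  have rle_y: "rle (R y) n (R (z n)) n" for n
    using wfy
  proof (induction n rule: wfp_induct_rule)
    case (less n)
    show ?case by (rule rleI) (use less.IH edge rle_rlt_trans in metis)
  qed
  have y: "y \<in> stage R n" for n
  proof (induction n)
    case (Suc n)
    show ?case unfolding stage.simps
    proof (intro CollectI conjI ballI impI Suc)
      fix w assume w: "w \<in> stage R n"
      then have zw: "rle (R (z n)) n (R w) n" "rle (R w) n (R (z n)) n \<longrightarrow> z n n \<le> w n" using z[of n] by auto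
      then show "rle (R y) n (R w) n" using rle_y rle_trans by metis
      assume "rle (R w) n (R y) n"
      then have "rle (R w) n (R (z n)) n" using rle_y rle_trans by metis
      then show "y n \<le> w n" using zw unfolding y_def by blast
    qed
  qed (use wfy in simp)
  have "\<not> lex_below R w y n" for w n
  proof
    assume below: "lex_below R w y n"
    have le_n: "rle (R w) n (R y) n"
      using below rlt_imp_rle[OF wfy, of "R w" n n] unfolding lex_below_def by blast
    \<comment> \<open>The comparison at the root alone makes the whole tree of \<open>w\<close>
      well-founded, so \<open>w\<close> enters stage \<open>0\<close> and can compete with
      \<open>y\<close>.\<close>
    then have "rle (R w) 0 (R y) 0"
      using below unfolding lex_below_def by (cases n) auto
    then have acc: "Wellfounded.accp (R w) 0" by (rule rle_accp[OF wfy])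
    have "Wellfounded.accp (R w) m" for m
      by (rule accp.accI, drule root) (rule accp_downward[OF acc])
    then have wfw: "wfp (R w)" by (simp add: accp_wfpI)
    have "w \<in> stage R i" if "i \<le> n" for i
      using that
    proof (induction i)
      case (Suc i)
      then have w: "w \<in> stage R i" "rle (R w) i (R y) i" "w i = y i"
        using below unfolding lex_below_def by auto
      have yi: "y \<in> stage R (Suc i)" using y .
      show ?case unfolding stage.simps
      proof (intro CollectI conjI ballI impI w)
        fix v assume v: "v \<in> stage R i"
        with yi have yv: "rle (R y) i (R v) i" "rle (R v) i (R y) i \<longrightarrow> y i \<le> v i" by auto
        show "rle (R w) i (R v) i" using rle_trans[OF w(2) yv(1)] .
        show "w i \<le> v i" if "rle (R v) i (R w) i"
          using rle_trans[OF that w(2)] yv(2) w(3) by simp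
      qed
    qed (use wfw in simp)
    then have "w \<in> stage R n" by blast
    moreover have "y \<in> stage R (Suc n)" using y .
    ultimately have "rle (R y) n (R w) n" "y n \<le> w n" using le_n by auto
    then have "rlt (R w) n (R y) n" using below unfolding lex_below_def by auto
    with \<open>rle (R y) n (R w) n\<close> have "rlt (R w) n (R w) n" by (metis rlt_rle_trans)
    with rlt_irrefl[OF wfw, of n] show False by blast
  qed
  then show ?thesis unfolding lex_least_def using wfy by blast
qed

section \<open>Splitting a mad family\<close>

lemma mad_family_iff:
  "mad_family \<A> \<longleftrightarrow> infinite \<A> \<and> almost_disjoint_family \<A> \<and>
     (\<forall>z. infinite z \<longrightarrow> (\<exists>x\<in>\<A>. infinite (x \<inter> z)))" (is "?L \<longleftrightarrow> ?R")
proof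
  assume L: ?L
  have "\<exists>x\<in>\<A>. infinite (x \<inter> z)" if "infinite z" for z
  proof (rule ccontr)
    assume *: "\<not> ?thesis"
    then have "almost_disjoint_family (insert z \<A>)"
      using L that unfolding mad_family_def almost_disjoint_family_def
      by (auto simp: pairwise_insert Int_commute)
    then have "z \<in> \<A>" using L unfolding mad_family_def by blast
    with * that show False by auto
  qed
  with L show ?R unfolding mad_family_def by blast
next
  assume R: ?R
  have "\<B> = \<A>" if B: "almost_disjoint_family \<B>" "\<A> \<subseteq> \<B>" for \<B>
  proof (rule ccontr)
    assume "\<B> \<noteq> \<A>"
    then obtain z where z: "z \<in> \<B>" "z \<notin> \<A>" using B by blast
    then have "infinite z" using B unfolding almost_disjoint_family_def by blast
    then obtain x where "x \<in> \<A>" "infinite (x \<inter> z)" using R by blast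
    moreover have "x \<noteq> z" using \<open>x \<in> \<A>\<close> z by blast
    ultimately show False using B z unfolding almost_disjoint_family_def pairwise_def by blast
  qed
  with R show ?L unfolding mad_family_def by blast
qed

lemma strict_mono_range_eq:
  fixes f g :: "nat \<Rightarrow> nat"
  assumes "strict_mono f" "strict_mono g" "range f = range g"
  shows "f = g"
proof
  fix n show "f n = g n"
  proof (induction n rule: less_induct)
    case (less n)
    obtain k where k: "f n = g k" using assms(3) by (metis rangeE rangeI)
    obtain l where l: "g n = f l" using assms(3) by (metis rangeE rangeI)
    have "\<not> k < n" using less k assms(1) by (metis nat_less_le strict_mono_eq)
    moreover have "\<not> l < n" using less l assms(2) by (metis nat_less_le strict_mono_eq)
    ultimately have "g n \<le> f n" "f n \<le> g n"
      using k l assms by (metis not_less strict_mono_less_eq)+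
    then show ?case by simp
  qed
qed

lemma infinite_div2_image:
  fixes S :: "nat set"
  assumes "infinite S"
  shows "infinite ((\<lambda>m. m div 2) ` S)"
proof
  assume "finite ((\<lambda>m. m div 2) ` S)"
  then obtain M where M: "\<And>m. m \<in> S \<Longrightarrow> m div 2 < M"
    unfolding finite_nat_set_iff_bounded by blast
  have "S \<subseteq> {..<2 * M}" using M by fastforce
  with assms show False using finite_subset by blast
qed

text \<open>
  The comparison with \<open>b 0\<close> makes the coding invariant under flipping all bits: every \<open>y\<close> is
  decoded from exactly two sequences of bits.
\<close>

definition decodes :: "(nat \<Rightarrow> nat) \<Rightarrow> (nat \<Rightarrow> nat) \<Rightarrow> bool" where
  "decodes b y \<longleftrightarrow> (\<forall>i j. b (prod_encode (i, j)) \<noteq> b 0 \<longleftrightarrow> j = Suc (y i))"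

lemma decodes_unique: "decodes b y \<Longrightarrow> decodes b z \<Longrightarrow> y = z"
  unfolding decodes_def by (metis Suc_inject ext)

lemma decodes_iff:
  assumes "decodes b y" "decodes b' y"
  shows "b k \<noteq> b 0 \<longleftrightarrow> b' k \<noteq> b' 0"
  using assms unfolding decodes_def by (metis prod_decode_inverse surj_pair)

text \<open>Here \<open>h\<close> enumerates \<open>w\<close> increasingly. Strict growth of the
  halves says that \<open>w\<close> takes exactly one of \<open>2 * m\<close> and
  \<open>2 * m + 1\<close> for each \<open>m\<close> in the underlying set; the parities are the
  coded bits.\<close>

definition splitting :: "nat set set \<Rightarrow> (nat set \<Rightarrow> nat \<Rightarrow> nat) \<Rightarrow> nat set set" where
  "splitting \<A> f = {w. \<exists>h. strict_mono (\<lambda>k. h k div 2) \<and> range h = w \<and>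
     range (\<lambda>k. h k div 2) \<in> \<A> \<and>
     decodes (\<lambda>k. h k mod 2) (f (range (\<lambda>k. h k div 2)))}"

lemma splitting_cover:
  assumes "x \<in> \<A>" "infinite x"
  obtains v w where "v \<in> splitting \<A> f" "w \<in> splitting \<A> f"
    "(\<lambda>m. m div 2) ` v = x" "\<And>m. m div 2 \<in> x \<Longrightarrow> m \<in> v \<union> w"
proof -
  define g where "g = enumerate x"
  have g: "strict_mono g" "range g = x"
    unfolding g_def using assms(2) by (auto simp: strict_mono_enumerate range_enumerate)
  define P where "P k \<longleftrightarrow> (\<exists>i. k = prod_encode (i, Suc (f x i)))" for k
  define h where "h c k = 2 * g k + (if P k then c else 1 - c)" for c k :: nat
  \<comment> \<open>Index \<open>0\<close> codes the pair of zeros. The \<open>Suc\<close> in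
    \<open>decodes\<close> keeps this reference position outside the pattern, so the value
    \<open>0\<close> can be coded too.\<close>
  have P0: "\<not> P 0"
  proof
    assume "P 0"
    then obtain i where "prod_encode (i, Suc (f x i)) = prod_encode (0, 0)"
      unfolding P_def by (auto simp: prod_encode_def)
    then show False by (simp only: prod_encode_eq) simp
  qed
  have P: "P (prod_encode (i, j)) \<longleftrightarrow> j = Suc (f x i)" for i j
    unfolding P_def by (auto simp: prod_encode_eq)
  have div: "(\<lambda>k. h c k div 2) = g" and md: "(\<lambda>k. h c k mod 2) = (\<lambda>k. if P k then c else 1 - c)"
    if "c \<in> {0, 1}" for c
    unfolding h_def using that by auto
  have dec: "decodes (\<lambda>k. if P k then c else 1 - c) (f x)" if "c \<in> {0, 1}" for c
    unfolding decodes_def using that P P0 by auto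
  have mem: "range (h c) \<in> splitting \<A> f" if "c \<in> {0, 1}" for c
    unfolding splitting_def
  proof (intro CollectI exI[of _ "h c"], unfold div[OF that] md[OF that] g(2))
    show "strict_mono g \<and> range (h c) = range (h c) \<and> x \<in> \<A> \<and>
      decodes (\<lambda>k. if P k then c else 1 - c) (f x)"
      using g dec[OF that] assms(1) by blast
  qed
  show thesis
  proof (rule that[OF mem mem])
    show "(\<lambda>m. m div 2) ` range (h 0) = x"
      unfolding image_image div[OF insertI1] by (rule g(2))
    fix m assume "m div 2 \<in> x"
    then obtain k where "m div 2 = g k" using g(2) by blast
    then have "m = h 0 k \<or> m = h 1 k" unfolding h_def by auto
    then show "m \<in> range (h 0) \<union> range (h 1)" by blast
  qed auto
qed

lemma splitting_div2: "w \<in> splitting \<A> f \<Longrightarrow> (\<lambda>m. m div 2) ` w \<in> \<A>"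
  unfolding splitting_def by (auto simp: image_image)

theorem mad_family_splitting:
  assumes "mad_family \<A>"
  shows "mad_family (splitting \<A> f)"
  unfolding mad_family_iff
proof (intro conjI allI impI)
  have A: "infinite \<A>" "\<And>x. x \<in> \<A> \<Longrightarrow> infinite x"
    "\<And>x y. x \<in> \<A> \<Longrightarrow> y \<in> \<A> \<Longrightarrow> infinite (x \<inter> y) \<Longrightarrow> x = y"
    "\<And>z. infinite z \<Longrightarrow> \<exists>x\<in>\<A>. infinite (x \<inter> z)"
    using assms unfolding mad_family_iff almost_disjoint_family_def pairwise_def by blast+
  have "\<A> \<subseteq> (`) (\<lambda>m. m div 2) ` splitting \<A> f"
  proof
    fix x assume x: "x \<in> \<A>"
    then show "x \<in> (`) (\<lambda>m. m div 2) ` splitting \<A> f"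
      by (rule splitting_cover[OF _ A(2)[OF x], of \<A> f]) blast
  qed
  then show "infinite (splitting \<A> f)" using A(1) finite_surj by blast
  show "almost_disjoint_family (splitting \<A> f)"
    unfolding almost_disjoint_family_def pairwise_def
  proof (intro conjI ballI impI)
    fix w assume "w \<in> splitting \<A> f"
    then show "infinite w" using splitting_div2 A(2) by blast
  next
    fix v w assume v: "v \<in> splitting \<A> f" and w: "w \<in> splitting \<A> f" and ne: "v \<noteq> w"
    obtain h where h: "strict_mono (\<lambda>k. h k div 2)" "range h = v" "range (\<lambda>k. h k div 2) \<in> \<A>"
      "decodes (\<lambda>k. h k mod 2) (f (range (\<lambda>k. h k div 2)))"
      using v unfolding splitting_def by blast
    obtain h' where h': "strict_mono (\<lambda>k. h' k div 2)" "range h' = w" "range (\<lambda>k. h' k div 2) \<in> \<A>"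
      "decodes (\<lambda>k. h' k mod 2) (f (range (\<lambda>k. h' k div 2)))"
      using w unfolding splitting_def by blast
    show "finite (v \<inter> w)"
    proof (rule ccontr)
      assume inf: "infinite (v \<inter> w)"
      \<comment> \<open>Over the same \<open>x\<close> the two bit sequences agree up to a global
        flip, and a single common element rules out the flip.\<close>
      then obtain m where m: "m \<in> v" "m \<in> w" by (metis IntE infinite_imp_nonempty all_not_in_conv)
      have "(\<lambda>m. m div 2) ` (v \<inter> w) \<subseteq> range (\<lambda>k. h k div 2) \<inter> range (\<lambda>k. h' k div 2)"
        using h(2) h'(2) by auto
      then have "infinite (range (\<lambda>k. h k div 2) \<inter> range (\<lambda>k. h' k div 2))"
        using infinite_div2_image[OF inf] finite_subset by blast
      then have "range (\<lambda>k. h k div 2) = range (\<lambda>k. h' k div 2)" using A(3) h(3) h'(3) by blast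
      then have div: "(\<lambda>k. h k div 2) = (\<lambda>k. h' k div 2)"
        using strict_mono_range_eq[OF h(1) h'(1)] by blast
      have bits: "h k mod 2 \<noteq> h 0 mod 2 \<longleftrightarrow> h' k mod 2 \<noteq> h' 0 mod 2" for k
        by (rule decodes_iff[OF h(4) h'(4)[folded div]])
      obtain k l where kl: "m = h k" "m = h' l" using m h(2) h'(2) by blast
      then have "h k div 2 = h l div 2" using div by metis
      then have "k = l" using strict_mono_eq[OF h(1)] by blast
      then have "even (h k) \<longleftrightarrow> even (h' k)" using kl by simp
      moreover have parity: "(even (h i) \<longleftrightarrow> even (h 0)) \<longleftrightarrow> (even (h' i) \<longleftrightarrow> even (h' 0))" for i
        using bits[of i] by (auto simp: mod2_eq_if split: if_splits)
      ultimately have "even (h i) \<longleftrightarrow> even (h' i)" for i using parity[of k] parity[of i] by argo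
      then have "h i mod 2 = h' i mod 2" for i by (simp add: mod2_eq_if)
      then have "h i = h' i" for i using fun_cong[OF div, of i] by (metis div_mult_mod_eq)
      then have "h = h'" ..
      then show False using h(2) h'(2) ne by simp
    qed
  qed
  fix z :: "nat set" assume "infinite z"
  then obtain x where x: "x \<in> \<A>" "infinite (x \<inter> (\<lambda>m. m div 2) ` z)"
    using A(4) infinite_div2_image by blast
  obtain v w where vw: "v \<in> splitting \<A> f" "w \<in> splitting \<A> f" "\<And>m. m div 2 \<in> x \<Longrightarrow> m \<in> v \<union> w"
    by (rule splitting_cover[OF x(1) A(2)[OF x(1)], of f]) blast
  have "x \<inter> (\<lambda>m. m div 2) ` z \<subseteq> (\<lambda>m. m div 2) ` ((v \<inter> z) \<union> (w \<inter> z))" using vw(3) by blast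
  then have "infinite ((v \<inter> z) \<union> (w \<inter> z))" using x(2) finite_subset by blast
  then have "infinite (v \<inter> z) \<or> infinite (w \<inter> z)" by simp
  then show "\<exists>x\<in>splitting \<A> f. infinite (x \<inter> z)" using vw(1,2) by blast
qed


section \<open>Definability\<close>

text \<open>
  \<open>Z\<close> codes one simulation serving all comparisons at once, since simulations are closed under
  unions.
\<close>

lemma lex_least_iff:
  "lex_least R y \<longleftrightarrow> (\<forall>z (Z :: nat \<Rightarrow> nat) u. \<not> (\<forall>k. R y (u (Suc k)) (u k)) \<and>
     \<not> (sim (R z) (R y) (\<lambda>i j. Z (prod_encode (i, j)) = 0) \<and>
        (\<exists>n. (\<forall>i<n. Z (prod_encode (i, i)) = 0 \<and> z i = y i) \<and>
          ((\<exists>b. R y b n \<and> Z (prod_encode (n, b)) = 0) \<or> Z (prod_encode (n, n)) = 0 \<and> z n < y n))))"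
    (is "_ \<longleftrightarrow> (\<forall>z Z u. \<not> ?C u \<and> \<not> ?B z Z)")
proof -
  have "wfp (R y) \<longleftrightarrow> (\<forall>u. \<not> ?C u)"
    unfolding wfp_def wf_iff_no_infinite_down_chain by simp
  moreover have "(\<forall>n. \<not> lex_below R z y n) \<longleftrightarrow> (\<forall>Z. \<not> ?B z Z)" for z
  proof -
   have "(\<exists>n. lex_below R z y n) \<longleftrightarrow> (\<exists>Z. ?B z Z)"
   proof
    assume "\<exists>n. lex_below R z y n"
    then obtain n where n: "lex_below R z y n" ..
    let ?Z = "\<lambda>p. if rle (R z) (fst (prod_decode p)) (R y) (snd (prod_decode p)) then 0 else 1 :: nat"
    have "?B z ?Z"
      using n sim_rle[of "R z" "R y"] unfolding lex_below_def rlt_def by auto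
    then show "\<exists>Z. ?B z Z" by (rule exI[of _ ?Z])
  next
    assume "\<exists>Z. ?B z Z"
    then obtain Z where Z: "?B z Z" ..
    then have *: "Z (prod_encode (i, j)) = 0 \<Longrightarrow> rle (R z) i (R y) j" for i j
      unfolding rle_def by (intro exI[of _ "\<lambda>i j. Z (prod_encode (i, j)) = 0"]) simp
    with Z show "\<exists>n. lex_below R z y n"
      unfolding lex_below_def rlt_def by blast
   qed
   then show ?thesis unfolding not_ex[symmetric] by (rule arg_cong[of _ _ Not])
  qed
  moreover have "(\<forall>u. \<not> C u) \<and> (\<forall>z Z. \<not> B z Z) \<longleftrightarrow> (\<forall>z Z u. \<not> C u \<and> \<not> B z Z)"
    for C :: "'u \<Rightarrow> bool" and B :: "'v \<Rightarrow> 'w \<Rightarrow> bool" by blast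
  ultimately show ?thesis unfolding lex_least_def by presburger
qed

definition column :: "nat \<Rightarrow> (nat \<Rightarrow> nat) \<Rightarrow> nat \<Rightarrow> nat" where
  "column i u k = u (prod_encode (i, k))"

text \<open>\<open>Pi11\<close> provides one function quantifier; the columns of one function can be
  prescribed independently, so it does the work of five.\<close>

lemma all_columns:
  "(\<forall>u. P (column 0 u) (column 1 u) (column 2 u) (column 3 u) (column 4 u)) \<longleftrightarrow> (\<forall>h y z Z v. P h y z Z v)"
proof (intro iffI allI)
  fix h y z Z v
  assume *: "\<forall>u. P (column 0 u) (column 1 u) (column 2 u) (column 3 u) (column 4 u)"
  define F where "F = (\<lambda>i :: nat. if i = 0 then h else if i = 1 then y else if i = 2 then z else if i = 3 then Z else v :: nat \<Rightarrow> nat)"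
  define u where "u p = F (fst (prod_decode p)) (snd (prod_decode p))" for p
  have "column i u = F i" for i unfolding column_def u_def by auto
  then show "P h y z Z v" using *[THEN spec, of u] unfolding F_def by simp
qed simp

lemma arnum_mod2: "arnum f \<Longrightarrow> arnum (\<lambda>e s. f e s mod 2)"
  using arnum_mod_Suc[OF _ arnum_const[of 1], of f] by (simp add: numeral_2_eq_2)

lemma arnum_if:
  assumes "arpred P" "arnum f" "arnum g"
  shows "arnum (\<lambda>e s. if P e s then f e s else g e s)"
proof -
  have "arpred (\<lambda>e s. (P (\<lambda>i. e (Suc i)) s \<and> e 0 = f (\<lambda>i. e (Suc i)) s) \<or>
      (\<not> P (\<lambda>i. e (Suc i)) s \<and> e 0 = g (\<lambda>i. e (Suc i)) s))"
    using assms unfolding arnum_def by (intro arpred_disj arpred_conj arpred_not arpred_rename[OF assms(1)])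
  then show ?thesis unfolding arnum_def by (rule back_subst[of arpred]) auto
qed

lemma arpred_subst5:
  assumes "arpred (\<lambda>e s. R (s 0) (s 1) (s 2) (e 0) (e 1))"
    and "arfun X" "arfun A" "arfun Y" "arnum f" "arnum g"
  shows "arpred (\<lambda>e s. R (X e s) (A e s) (Y e s) (f e s) (g e s))"
proof -
  let ?F = "\<lambda>e s i. if i = (0 :: nat) then f e s else g e s"
  let ?G = "\<lambda>e s i. if i = (0 :: nat) then X e s else if i = 1 then A e s else Y e s"
  have "arpred (\<lambda>e s. R (?G e s 0) (?G e s 1) (?G e s 2) (?F e s 0) (?F e s 1))"
  proof (rule arpred_subst[OF assms(1), where F = ?F and G = ?G])
    show "arnum (\<lambda>e s. ?F e s i)" for i using assms by (cases "i = 0") auto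
    show "arfun (\<lambda>e s. ?G e s i)" for i using assms by (cases "i = 0"; cases "i = 1") auto
  qed
  then show ?thesis by simp
qed

lemma Sigma12_wfp:
  assumes "Sigma12 a \<A>"
  obtains R where "arpred (\<lambda>e s. R (s 0) (s 1) (s 2) (e 0) (e 1))"
    "\<And>x y m n. R x a y m n \<Longrightarrow> \<exists>N. \<forall>z. (\<forall>i<N. z i = y i) \<longrightarrow> R x a z m n"
    "\<And>x y m n. R x a y m n \<Longrightarrow> R x a y m 0"
    "\<A> = {x. \<exists>y. wfp (R (indicator x) a y)}"
proof -
  obtain v u \<phi> where \<phi>: "arithmetical \<phi>"
    and A: "\<A> = {x. \<exists>f. \<forall>g. holds (\<lambda>_. 0) ((\<lambda>_ _. 0)(0 := indicator x, 1 := a, v := f, u := g)) \<phi>}"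
    using assms unfolding Sigma12_def defines_from_def by auto
  \<comment> \<open>The bound indices \<open>v\<close> and \<open>u\<close> may coincide with
    \<open>0\<close>, \<open>1\<close> or each other. \<open>Q\<close> moves the four functions to
    fixed slots, while the order of the updates preserves the shadowing.\<close>
  define Q where "Q s = holds (\<lambda>_. 0) ((\<lambda>_ _. 0)(0 := s 0, 1 := s 1, v := s 2, u := s 3)) \<phi>"
    for s :: "nat \<Rightarrow> nat \<Rightarrow> nat"
  have zero: "arfun (\<lambda>e s _. 0)" by (intro arfunI arnum_const)
  have "arpred (\<lambda>e s. Q s)"
    unfolding Q_def
  proof (rule arpred_holds_subst[OF \<phi> arnum_const])
    show "arfun (\<lambda>e s. ((\<lambda>_ _. 0)(0 := s 0, 1 := s 1, v := s 2, u := s 3)) i)" for i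
      by (cases "i = u"; cases "i = v"; cases "i = 1"; cases "i = 0") (simp_all add: arfun_var zero)
  qed
  then obtain \<psi> where \<psi>: "arithmetical \<psi>" "\<And>e s. holds e s \<psi> \<longleftrightarrow> Q s" unfolding arpred_def by blast
  obtain \<theta> where \<theta>: "kernel \<theta>" "\<And>e s. \<not> Q s \<longleftrightarrow> (\<exists>w. \<forall>n. \<theta> n w e s)"
    using conjunct2[OF normal_form_holds[OF \<psi>(1)]] unfolding normal_form_def \<psi>(2) by blast
  \<comment> \<open>A branch of the tree carries two functions: the Skolem function for the failure
    of \<open>Q\<close> at even places and the counterexample to the inner universal quantifier at
    odd places.\<close>
  define \<sigma> where "\<sigma> w x b y = (\<lambda>i. if i = 0 then x else if i = 1 then b else if i = 2 then y
      else if i = (3 :: nat) then (\<lambda>k. w (Suc (2 * k))) else (\<lambda>_. 0))"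
    for w x b y :: "nat \<Rightarrow> nat"
  define \<Theta> where "\<Theta> n w x b y \<longleftrightarrow> \<theta> n (\<lambda>k. w (2 * k)) (\<lambda>_. 0) (\<sigma> w x b y)" for n w x b y
  \<comment> \<open>The numbering follows the quantifiers of \<open>tree\<close>: \<open>r\<close>
    is innermost with index 0, then \<open>q\<close>, then \<open>k\<close>.\<close>
  have ar\<Theta>: "arpred (\<lambda>e s. \<Theta> (e (Suc (Suc 0))) (beta (e (Suc 0))) (s 0) (s 1) (beta (e 0)))"
  proof -
    let ?F = "\<lambda>e s. case_nat (e (Suc (Suc 0))) (\<lambda>_. 0)"
    let ?G = "\<lambda>e s. case_nat (\<lambda>k. beta (e (Suc 0)) (2 * k)) (\<sigma> (beta (e (Suc 0))) (s 0) (s 1) (beta (e 0)))"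
    have "arpred (\<lambda>e s. \<theta> (?F e s 0) (?G e s 0) (\<lambda>i. ?F e s (Suc i)) (\<lambda>i. ?G e s (Suc i)))"
    proof (rule arpred_subst[where F = ?F and G = ?G])
      show "arpred (\<lambda>e s. \<theta> (e 0) (s 0) (\<lambda>i. e (Suc i)) (\<lambda>i. s (Suc i)))"
        using \<theta>(1) unfolding kernel_def by blast
      show "arnum (\<lambda>e s. ?F e s i)" for i
        by (cases i) (simp_all add: arnum_var arnum_const)
      have "arfun (\<lambda>e s. \<sigma> (beta (e (Suc 0))) (s 0) (s 1) (beta (e 0)) i)" for i
        unfolding \<sigma>_def
        by (cases "i = 0"; cases "i = 1"; cases "i = 2"; cases "i = 3")
          (simp_all add: arfun_var zero, (intro arfunI arnum_beta arnum_mult arnum_Suc arnum_var arnum_const)+)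
      moreover have "arfun (\<lambda>e s k. beta (e (Suc 0)) (2 * k))"
        by (intro arfunI arnum_beta arnum_mult arnum_Suc arnum_var arnum_const)
      ultimately show "arfun (\<lambda>e s. ?G e s i)" for i
        by (cases i) simp_all
    qed
    then show ?thesis unfolding \<Theta>_def by simp
  qed
  define R where "R x b y = tree (\<lambda>n w y. \<Theta> n w x b y) y" for x b y
  show thesis
  proof (rule that[of R])
    show "arpred (\<lambda>e s. R (s 0) (s 1) (s 2) (e 0) (e 1))"
      unfolding R_def tree_def
      by (intro arpred_conj arpred_all arpred_ex arpred_imp arpred_less arpred_eq
          arnum_fst_prod_decode arnum_snd_prod_decode arnum_beta arnum_var arnum_app ar\<Theta>)
    show "R x a y m n \<Longrightarrow> \<exists>N. \<forall>z. (\<forall>i<N. z i = y i) \<longrightarrow> R x a z m n" for x y m n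
      unfolding R_def by (rule tree_continuous)
    show "R x a y m n \<Longrightarrow> R x a y m 0" for x y m n
      unfolding R_def by (rule tree_root)
    \<comment> \<open>Halving the index makes the odd places of the padded function list
      \<open>g\<close> itself, so slot 3 of \<sigma> is exactly \<open>g\<close>.\<close>
    have "wfp (R x a y) \<longleftrightarrow> (\<forall>g. Q (\<sigma> (\<lambda>k. g (k div 2)) x a y))" for x y
    proof -
      have "wfp (R x a y) \<longleftrightarrow> (\<forall>w. \<exists>n. \<not> \<Theta> n w x a y)"
        unfolding R_def
      proof (rule wfp_tree)
        fix n w y
        obtain N where N: "\<forall>w' s'. (\<forall>i<N. w' i = w (2 * i)) \<and> (\<forall>i<N. \<forall>j<N. s' i j = \<sigma> w x a y i j) \<longrightarrow>
            \<theta> n w' (\<lambda>_. 0) s' = \<theta> n (\<lambda>k. w (2 * k)) (\<lambda>_. 0) (\<sigma> w x a y)"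
          using continuous_kernelD[OF conjunct1[OF \<theta>(1)[unfolded kernel_def]]] ..
        show "\<exists>N. \<forall>w' y'. (\<forall>i<N. w' i = w i) \<and> (\<forall>i<N. y' i = y i) \<longrightarrow> \<Theta> n w' x a y' = \<Theta> n w x a y"
        proof (intro exI[of _ "2 * N"] allI impI)
          fix w' y' assume *: "(\<forall>i<2 * N. w' i = w i) \<and> (\<forall>i<2 * N. y' i = y i)"
          show "\<Theta> n w' x a y' = \<Theta> n w x a y"
            unfolding \<Theta>_def
            by (rule N[THEN spec, THEN spec, THEN mp]) (use * in \<open>auto simp: \<sigma>_def\<close>)
        qed
      qed
      also have "\<dots> \<longleftrightarrow> (\<forall>g. Q (\<sigma> (\<lambda>k. g (k div 2)) x a y))"
      proof (intro iffI allI)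
        fix g assume *: "\<forall>w. \<exists>n. \<not> \<Theta> n w x a y"
        show "Q (\<sigma> (\<lambda>k. g (k div 2)) x a y)"
        proof (rule ccontr)
          assume "\<not> Q (\<sigma> (\<lambda>k. g (k div 2)) x a y)"
          then obtain w where w: "\<And>n. \<theta> n w (\<lambda>_. 0) (\<sigma> (\<lambda>k. g (k div 2)) x a y)" using \<theta>(2) by blast
          define w' where "w' k = (if even k then w (k div 2) else g (k div 2))" for k
          have "(\<lambda>k. w' (2 * k)) = w" "\<sigma> w' x a y = \<sigma> (\<lambda>k. g (k div 2)) x a y"
            unfolding w'_def \<sigma>_def by auto
          with w have "\<Theta> n w' x a y" for n unfolding \<Theta>_def by simp
          with * show False by blast
        qed
      next
        fix w assume *: "\<forall>g. Q (\<sigma> (\<lambda>k. g (k div 2)) x a y)"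
        have "\<sigma> (\<lambda>k. w (Suc (2 * (k div 2)))) x a y = \<sigma> w x a y" unfolding \<sigma>_def by auto
        with *[THEN spec, of "\<lambda>k. w (Suc (2 * k))"] have "Q (\<sigma> w x a y)" by simp
        then show "\<exists>n. \<not> \<Theta> n w x a y" using \<theta>(2) unfolding \<Theta>_def by blast
      qed
      finally show ?thesis .
    qed
    moreover have "Q (\<sigma> (\<lambda>k. g (k div 2)) x a y) \<longleftrightarrow> holds (\<lambda>_. 0) ((\<lambda>_ _. 0)(0 := x, 1 := a, v := y, u := g)) \<phi>" for g x y
      unfolding Q_def \<sigma>_def by simp
    ultimately show "\<A> = {x. \<exists>y. wfp (R (indicator x) a y)}" unfolding A by simp
  qed
qed

section \<open>The formula defining the new family\<close>

definition halves :: "(nat \<Rightarrow> nat) \<Rightarrow> nat \<Rightarrow> nat" where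
  "halves h n = (if \<exists>k. h k div 2 = n then 1 else 0)"

lemma halves_eq: "halves h = indicator (range (\<lambda>k. h k div 2))"
  unfolding halves_def by (auto simp: indicator_def fun_eq_iff)

definition refuted :: "(nat \<Rightarrow> nat \<Rightarrow> bool) \<Rightarrow> (nat \<Rightarrow> nat \<Rightarrow> bool) \<Rightarrow> (nat \<Rightarrow> nat) \<Rightarrow> (nat \<Rightarrow> nat) \<Rightarrow> (nat \<Rightarrow> nat) \<Rightarrow> (nat \<Rightarrow> nat) \<Rightarrow> bool" where
  "refuted S T y z Z u \<longleftrightarrow> (\<forall>k. T (u (Suc k)) (u k)) \<or>
     ((\<forall>i j. Z (prod_encode (i, j)) = 0 \<longrightarrow>
         (\<forall>i'. S i' i \<longrightarrow> (\<exists>j'. T j' j \<and> Z (prod_encode (i', j')) = 0))) \<and>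
        (\<exists>n. (\<forall>i<n. Z (prod_encode (i, i)) = 0 \<and> z i = y i) \<and>
          ((\<exists>b. T b n \<and> Z (prod_encode (n, b)) = 0) \<or> Z (prod_encode (n, n)) = 0 \<and> z n < y n)))"

lemma lex_least_refuted: "lex_least R y \<longleftrightarrow> (\<forall>z Z u. \<not> refuted (R z) (R y) y z Z u)"
  unfolding lex_least_iff refuted_def sim_def by simp

text \<open>
  Since \<open>h\<close> and \<open>y\<close> are determined by \<open>w\<close>, they can be quantified universally once their existence has
  been stated arithmetically.
\<close>

definition matrix ::
  "((nat \<Rightarrow> nat) \<Rightarrow> (nat \<Rightarrow> nat) \<Rightarrow> (nat \<Rightarrow> nat) \<Rightarrow> nat \<Rightarrow> nat \<Rightarrow> bool) \<Rightarrow>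
   (nat \<Rightarrow> nat) \<Rightarrow> (nat \<Rightarrow> nat) \<Rightarrow> (nat \<Rightarrow> nat) \<Rightarrow> (nat \<Rightarrow> nat) \<Rightarrow> (nat \<Rightarrow> nat) \<Rightarrow> (nat \<Rightarrow> nat) \<Rightarrow> (nat \<Rightarrow> nat) \<Rightarrow> bool"
where
  "matrix R w a h y z Z u \<longleftrightarrow>
     (\<forall>m. \<exists>n. m < n \<and> w n = 1) \<and>
     ((\<forall>k. h k < h (Suc k)) \<and> (\<forall>n. w n = 1 \<longleftrightarrow> (\<exists>k. h k = n)) \<longrightarrow>
        (\<forall>k. h k div 2 < h (Suc k) div 2) \<and>
        (\<forall>i. \<exists>m. \<forall>j. h (prod_encode (i, j)) mod 2 \<noteq> h 0 mod 2 \<longleftrightarrow> j = Suc m) \<and>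
        ((\<forall>i j. h (prod_encode (i, j)) mod 2 \<noteq> h 0 mod 2 \<longleftrightarrow> j = Suc (y i)) \<longrightarrow>
           \<not> refuted (R (halves h) a z) (R (halves h) a y) y z Z u))"

lemma arpred_matrix:
  assumes R: "arpred (\<lambda>e s. R (s 0) (s 1) (s 2) (e 0) (e 1))"
  shows "arpred (\<lambda>e s. matrix R (s 0) (s 1) (s 2) (s 3) (s 4) (s 5) (s 6))"
proof -
  have H: "arfun (\<lambda>e s. halves (s 2))"
    unfolding halves_def
    by (intro arfunI arnum_if arpred_ex arpred_eq arnum_div2 arnum_app arnum_var arnum_const)
  show ?thesis
    unfolding matrix_def refuted_def
    by (intro arpred_conj arpred_disj arpred_all arpred_ex arpred_imp arpred_iff arpred_not arpred_less arpred_eq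
        arpred_subst5[OF R] H arfun_var
          arnum_prod_encode arnum_var arnum_app arnum_const arnum_Suc arnum_div2 arnum_mod2)
qed

text \<open>The unboundedness clause gives \<open>infinite w\<close>, hence an increasing
  enumeration; without it a finite \<open>w\<close> would satisfy the implication vacuously.\<close>

lemma all_matrix_iff:
  "(\<forall>h y z Z u. matrix R (indicator w) a h y z Z u) \<longleftrightarrow>
     infinite w \<and> (\<forall>h. strict_mono h \<and> range h = w \<longrightarrow>
        strict_mono (\<lambda>k. h k div 2) \<and> (\<exists>y. decodes (\<lambda>k. h k mod 2) y) \<and>
        (\<forall>y. decodes (\<lambda>k. h k mod 2) y \<longrightarrow> lex_least (R (indicator (range (\<lambda>k. h k div 2))) a) y))"
proof -
  have 1: "(\<forall>m. \<exists>n. m < n \<and> indicator w n = (1 :: nat)) \<longleftrightarrow> infinite w"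
    by (auto simp: infinite_nat_iff_unbounded indicator_def)
  have 2: "(\<forall>k. h k < h (Suc k)) \<longleftrightarrow> strict_mono h" for h :: "nat \<Rightarrow> nat"
    by (simp add: strict_mono_Suc_iff)
  have 3: "(\<forall>n. indicator w n = (1 :: nat) \<longleftrightarrow> (\<exists>k. h k = n)) \<longleftrightarrow> range h = w" for h :: "nat \<Rightarrow> nat"
    by (auto simp: indicator_def)
  \<comment> \<open>Choice turns the existence of a function \<open>y\<close> into the existence of
    a number for each \<open>i\<close>, so no existential function quantifier is spent.\<close>
  have 4: "(\<forall>i. \<exists>m. \<forall>j. h (prod_encode (i, j)) mod 2 \<noteq> h 0 mod 2 \<longleftrightarrow> j = Suc m) \<longleftrightarrow>
      (\<exists>y. decodes (\<lambda>k. h k mod 2) y)" for h :: "nat \<Rightarrow> nat"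
    unfolding decodes_def by (rule choice_iff)
  have 5: "(\<forall>i j. h (prod_encode (i, j)) mod 2 \<noteq> h 0 mod 2 \<longleftrightarrow> j = Suc (y i)) \<longleftrightarrow>
      decodes (\<lambda>k. h k mod 2) y" for h y :: "nat \<Rightarrow> nat"
    unfolding decodes_def by (rule refl)
  have 6: "(\<forall>k. h k div 2 < h (Suc k) div 2) \<longleftrightarrow> strict_mono (\<lambda>k. h k div 2)" for h :: "nat \<Rightarrow> nat"
    by (simp add: strict_mono_Suc_iff)
  show ?thesis
    unfolding matrix_def 1 2 3 4 5 6 lex_least_refuted halves_eq by auto
qed

lemma splitting_eq_matrix:
  fixes f :: "nat set \<Rightarrow> nat \<Rightarrow> nat"
  assumes f: "\<And>x b. x \<in> \<A> \<and> decodes b (f x) \<longleftrightarrow>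
      (\<exists>y. lex_least (R (indicator x) a) y \<and> decodes b y)"
  shows "splitting \<A> f = {w. \<forall>h y z Z u. matrix R (indicator w) a h y z Z u}"
proof (rule set_eqI)
  fix w
  let ?L = "\<lambda>h :: nat \<Rightarrow> nat. lex_least (R (indicator (range (\<lambda>k. h k div 2))) a)"
  have "w \<in> splitting \<A> f \<longleftrightarrow> (\<exists>h. strict_mono (\<lambda>k. h k div 2) \<and> range h = w \<and>
      (\<exists>y. ?L h y \<and> decodes (\<lambda>k. h k mod 2) y))"
    unfolding splitting_def f mem_Collect_eq by (rule refl)
  also have "\<dots> \<longleftrightarrow> infinite w \<and> (\<forall>h. strict_mono h \<and> range h = w \<longrightarrow>
      strict_mono (\<lambda>k. h k div 2) \<and> (\<exists>y. decodes (\<lambda>k. h k mod 2) y) \<and>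
      (\<forall>y. decodes (\<lambda>k. h k mod 2) y \<longrightarrow> ?L h y))"
    (is "(\<exists>h. ?P h) \<longleftrightarrow> infinite w \<and> (\<forall>h. _ \<longrightarrow> ?Q h)")
  proof
    assume "\<exists>h. ?P h"
    then obtain h y where h: "strict_mono (\<lambda>k. h k div 2)" "range h = w" "?L h y"
      "decodes (\<lambda>k. h k mod 2) y"
      by blast
    have "strict_mono h"
      using h(1) unfolding strict_mono_Suc_iff by (metis div_le_mono not_less)
    moreover have "?Q h" using h decodes_unique by blast
    ultimately show "infinite w \<and> (\<forall>h. strict_mono h \<and> range h = w \<longrightarrow> ?Q h)"
      using h(2) strict_mono_range_eq range_inj_infinite strict_mono_imp_inj_on by metis
  next
    assume *: "infinite w \<and> (\<forall>h. strict_mono h \<and> range h = w \<longrightarrow> ?Q h)"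
    then have "?Q (enumerate w)" by (simp add: strict_mono_enumerate range_enumerate)
    moreover have "range (enumerate w) = w" using * by (simp add: range_enumerate)
    ultimately show "\<exists>h. ?P h" by blast
  qed
  also have "\<dots> \<longleftrightarrow> w \<in> {w. \<forall>h y z Z u. matrix R (indicator w) a h y z Z u}"
    unfolding mem_Collect_eq all_matrix_iff by (rule refl)
  finally show "w \<in> splitting \<A> f \<longleftrightarrow> w \<in> {w. \<forall>h y z Z u. matrix R (indicator w) a h y z Z u}" .
qed

lemma Pi11_matrix:
  assumes R: "arpred (\<lambda>e s. R (s 0) (s 1) (s 2) (e 0) (e 1))"
  shows "Pi11 a {w. \<forall>h y z Z u. matrix R (indicator w) a h y z Z u}"
proof -
  let ?G = "\<lambda>e s i. if i < 2 then s i else column (i - 2) (s 2)"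
  have "arpred (\<lambda>e s. matrix R (?G e s 0) (?G e s 1) (?G e s 2) (?G e s 3) (?G e s 4) (?G e s 5) (?G e s 6))"
  proof (rule arpred_subst[OF arpred_matrix[OF R], where F = "\<lambda>e s. e" and G = ?G])
    show "arfun (\<lambda>e s. ?G e s i)" for i
    proof (cases "i < 2")
      case False
      have "arfun (\<lambda>e s. column (i - 2) (s 2))"
        unfolding column_def by (intro arfunI arnum_app arnum_prod_encode arnum_const arnum_var)
      with False show ?thesis by simp
    qed (simp add: arfun_var)
  qed (rule arnum_var)
  then have "arpred (\<lambda>e s. matrix R (s 0) (s 1) (column 0 (s 2)) (column 1 (s 2))
      (column 2 (s 2)) (column 3 (s 2)) (column 4 (s 2)))" by simp
  from Pi11I[OF this, of a] show ?thesis unfolding all_columns .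
qed

theorem theorem1:
  fixes a :: "nat \<Rightarrow> nat"
  assumes "\<exists>\<A>\<^sub>0. mad_family \<A>\<^sub>0 \<and> Sigma12 a \<A>\<^sub>0"
  shows "\<exists>\<A>. mad_family \<A> \<and> Pi11 a \<A>"
proof -
  obtain \<A>\<^sub>0 where A0: "mad_family \<A>\<^sub>0" "Sigma12 a \<A>\<^sub>0" using assms by blast
  from A0(2) show ?thesis
  proof (rule Sigma12_wfp)
    fix R
    assume R: "arpred (\<lambda>e s. R (s 0) (s 1) (s 2) (e 0) (e 1))"
      "\<And>x y m n. R x a y m n \<Longrightarrow> \<exists>N. \<forall>z. (\<forall>i<N. z i = y i) \<longrightarrow> R x a z m n"
      "\<And>x y m n. R x a y m n \<Longrightarrow> R x a y m 0"
      "\<A>\<^sub>0 = {x. \<exists>y. wfp (R (indicator x) a y)}"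
    define L where "L x = lex_least (R (indicator x) a)" for x
    define f where "f x = (THE y. L x y)" for x
    have mem: "x \<in> \<A>\<^sub>0 \<longleftrightarrow> (\<exists>y. L x y)" for x
    proof
      assume "x \<in> \<A>\<^sub>0"
      then obtain y where "wfp (R (indicator x) a y)" unfolding R(4) by blast
      then show "\<exists>y. L x y" unfolding L_def
        by (rule lex_least_exists[where R = "R (indicator x) a", rotated 2]) (fact R(2), fact R(3))
    next
      assume "\<exists>y. L x y"
      then obtain y where "L x y" ..
      then have "wfp (R (indicator x) a y)" unfolding L_def lex_least_def by (rule conjunct1)
      then show "x \<in> \<A>\<^sub>0" unfolding R(4) by blast
    qed
    have "L x y \<Longrightarrow> f x = y" for x y
      unfolding f_def by (rule the_equality) (auto simp: L_def intro: lex_least_unique)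
    \<comment> \<open>Outside \<open>\<A>\<^sub>0\<close> the value of \<open>f\<close> is
      arbitrary, but there both sides are false.\<close>
    then have uniform: "x \<in> \<A>\<^sub>0 \<and> decodes b (f x) \<longleftrightarrow> (\<exists>y. L x y \<and> decodes b y)" for x b
      using mem by metis
    have "splitting \<A>\<^sub>0 f = {w. \<forall>h y z Z u. matrix R (indicator w) a h y z Z u}"
      by (rule splitting_eq_matrix[where \<A> = "\<A>\<^sub>0" and f = f and R = R and a = a])
        (rule uniform[unfolded L_def])
    with Pi11_matrix[OF R(1), of a] have "Pi11 a (splitting \<A>\<^sub>0 f)" by simp
    with mad_family_splitting[OF A0(1)] show ?thesis by blast
  qed
qed

end
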